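(* For every $n\in\mathbb N=\{0,1,2,\dots\}$, the holomorphic Fourier transform $$\mathscr F(f)(z)=\int_0^\infty f(x)e^{izx}\,dx,\qquad z\in\mathbb C^+,$$ defines an isometric isomorphism from $L_n^2(\mathbb R^+)$ onto $H_n^2(\mathbb C^+)$.
   Context: $\mathbb C^+=\{z\in\mathbb C:\operatorname{Im} z>0\}$, $\mathbb R^+=(0,\infty)$. $L_n^2(\mathbb R^+)$ is the space of (classes of) measurable $f:\mathbb R^+\to\mathbb C$ with $$\|f\|_{L_n^2}=\left(\sum_{k=0}^n\int_0^\infty|f(x)|^2\,2\pi x^{2k}\,dx\right)^{1/2}<\infty.$$ $H^2(\mathbb C^+)$ is the Hardy space of holomorphic $F$ on $\mathbb C^+$ with $\|F\|_{H^2}=\sup_{y>0}\left(\int_{\mathbb R}|F(x+iy)|^2\,dx\right)^{1/2}<\infty$. $H_n^2(\mathbb C^+)$ is the space of holomorphic $F$ on $\mathbb C^+$ with $F^{(k)}\in H^2(\mathbb C^+)$ for $k=0,1,\dots,n$, with norm $\|F\|_{H_n^2}=\left(\sum_{k=0}^n\|F^{(k)}\|_{H^2}^2\right)^{1/2}$. *)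

theory Defs
  imports "HOL-Complex_Analysis.Complex_Analysis"
begin

definition Cplus :: "complex set" where
  "Cplus = {z. Im z > 0}"

definition esqrt :: "ennreal \<Rightarrow> ennreal" where
  "esqrt a = (if a = top then top else ennreal (sqrt (enn2real a)))"

record 'v normed_cspace =
  vecs :: "'v set"
  vadd :: "'v \<Rightarrow> 'v \<Rightarrow> 'v"
  vscale :: "complex \<Rightarrow> 'v \<Rightarrow> 'v"
  vnorm :: "'v \<Rightarrow> real"

definition isometric_isomorphism ::
  "'v normed_cspace \<Rightarrow> 'w normed_cspace \<Rightarrow> ('v \<Rightarrow> 'w) \<Rightarrow> bool" where
  "isometric_isomorphism V W T \<longleftrightarrow>
     bij_betw T (vecs V) (vecs W) \<and>
     (\<forall>u\<in>vecs V. \<forall>v\<in>vecs V. T (vadd V u v) = vadd W (T u) (T v)) \<and>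
     (\<forall>c. \<forall>u\<in>vecs V. T (vscale V c u) = vscale W c (T u)) \<and>
     (\<forall>u\<in>vecs V. vnorm W (T u) = vnorm V u)"


text \<open>Functions on \<open>(0,\<infinity>)\<close> are total functions on the reals whose values outside \<open>(0,\<infinity>)\<close>
  are irrelevant: measurability, the norm and the equivalence relation only involve
  \<open>lebesgue_on {0<..}\<close>.\<close>

definition L2_fun_norm :: "nat \<Rightarrow> (real \<Rightarrow> complex) \<Rightarrow> ennreal" where
  "L2_fun_norm n f =
     esqrt (\<Sum>k\<le>n. \<integral>\<^sup>+x. ennreal ((cmod (f x))\<^sup>2 * (2 * pi * x ^ (2 * k))) \<partial>lebesgue_on {0<..})"

definition L2_fun :: "nat \<Rightarrow> (real \<Rightarrow> complex) set" where
  "L2_fun n = {f \<in> borel_measurable (lebesgue_on {0<..}). L2_fun_norm n f < top}"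

definition ae_rel :: "nat \<Rightarrow> ((real \<Rightarrow> complex) \<times> (real \<Rightarrow> complex)) set" where
  "ae_rel n = {(f, g). f \<in> L2_fun n \<and> g \<in> L2_fun n \<and> (AE x in lebesgue_on {0<..}. f x = g x)}"

definition L2 :: "nat \<Rightarrow> (real \<Rightarrow> complex) set normed_cspace" where
  "L2 n = \<lparr>
     vecs = L2_fun n // ae_rel n,
     vadd = (\<lambda>A B. \<Union>f\<in>A. \<Union>g\<in>B. ae_rel n `` {\<lambda>x. f x + g x}),
     vscale = (\<lambda>c A. \<Union>f\<in>A. ae_rel n `` {\<lambda>x. c * f x}),
     vnorm = (\<lambda>A. enn2real (the_elem (L2_fun_norm n ` A)))\<rparr>"


definition hardy_norm :: "(complex \<Rightarrow> complex) \<Rightarrow> ennreal" where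
  "hardy_norm F =
     (SUP y\<in>{0<..}. esqrt (\<integral>\<^sup>+x. ennreal ((cmod (F (Complex x y)))\<^sup>2) \<partial>lborel))"

definition in_hardy :: "(complex \<Rightarrow> complex) \<Rightarrow> bool" where
  "in_hardy F \<longleftrightarrow> F holomorphic_on Cplus \<and> hardy_norm F < top"

text \<open>A function on the half-plane is represented by its extension by zero to all of \<open>\<complex>\<close>,
  so that equality in the space is equality on the half-plane. Since the half-plane is open,
  the extension does not affect the derivatives there.\<close>

definition H2 :: "nat \<Rightarrow> (complex \<Rightarrow> complex) normed_cspace" where
  "H2 n = \<lparr>
     vecs = {F. (\<forall>z. z \<notin> Cplus \<longrightarrow> F z = 0) \<and> F holomorphic_on Cplus \<and>
                (\<forall>k\<le>n. in_hardy ((deriv ^^ k) F))},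
     vadd = (\<lambda>F G z. F z + G z),
     vscale = (\<lambda>c F z. c * F z),
     vnorm = (\<lambda>F. enn2real (esqrt (\<Sum>k\<le>n. (hardy_norm ((deriv ^^ k) F))\<^sup>2)))\<rparr>"


definition hol_fourier :: "(real \<Rightarrow> complex) \<Rightarrow> complex \<Rightarrow> complex" where
  "hol_fourier f z =
     (if z \<in> Cplus then LINT x|lebesgue_on {0<..}. f x * exp (\<i> * z * of_real x) else 0)"

text \<open>The induced map on classes; it is meaningful only where \<^const>\<open>hol_fourier\<close> is constant
  on the class.\<close>

definition hol_fourier_class :: "(real \<Rightarrow> complex) set \<Rightarrow> complex \<Rightarrow> complex" where
  "hol_fourier_class A = the_elem (hol_fourier ` A)"

end

theory Submission
  imports Defs "HOL-Probability.Levy"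
begin

text \<open>
  Write \<open>T f\<close> for the holomorphic Fourier transform. Differentiation under the integral turns
  the \<open>k\<close>-th derivative of \<open>T f\<close> into \<open>T ((\<i>t)\<^sup>k f)\<close>, and the \<open>k\<close>-th summand of the squared
  norm of \<open>L\<^sub>n\<^sup>2\<close> is \<open>2\<pi>\<close> times the squared \<open>L\<^sup>2\<close> norm of \<open>(\<i>t)\<^sup>k f\<close>. So the case of general \<open>n\<close> reduces
  to one identity, in which both sides may be infinite:
  \<open>\<parallel>T f\<parallel>\<^sup>2 = 2\<pi> \<integral>|f|\<^sup>2\<close> in \<open>H\<^sup>2\<close> (lemma \<open>hardy_norm_fourier\<close>), together with the injectivity
  and the surjectivity of \<open>T\<close>.

  Three facts carry the proof; \<open>g\<close> denotes an integrable function on the line.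

  \<^item> Bessel's inequality \<open>\<integral>|\<g>|\<^sup>2 \<le> 2\<pi> \<integral>|g|\<^sup>2\<close>, where \<open>\<g>\<close> is the transform
    (\<open>fourier_bessel\<close>). After multiplying \<open>|\<g>|\<^sup>2\<close> by a Gaussian, Fubini rewrites the left side as a
    double integral of \<open>g(s) cnj (g(t))\<close> against a Gaussian of mass \<open>2\<pi>\<close>, which the inequality
    between the arithmetic and the geometric mean bounds; Fatou removes the Gaussian.
  \<^item> A vanishing transform forces \<open>g = 0\<close> almost everywhere (\<open>fourier_injective\<close>), because
    characteristic functions determine probability measures.
  \<^item> The Paley-Wiener theorem with the sharp constant (\<open>Paley_Wiener\<close>): if \<open>F\<close> is holomorphic in
    the half-plane and the integral of \<open>|F|\<^sup>2\<close> over every horizontal line is at most \<open>M\<close>, then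
    \<open>F = T f\<close> with \<open>2\<pi> \<integral>|f|\<^sup>2 \<le> M\<close>.

  Applied to \<open>t \<mapsto> f(t) exp(-yt)\<close>, Bessel's inequality gives \<open>\<parallel>T f\<parallel>\<^sup>2 \<le> 2\<pi> \<integral>|f|\<^sup>2\<close>. Conversely,
  if \<open>T f\<close> lies in \<open>H\<^sup>2\<close>, then Paley-Wiener represents it as \<open>T h\<close> with \<open>2\<pi> \<integral>|h|\<^sup>2 \<le> \<parallel>T f\<parallel>\<^sup>2\<close>, and
  injectivity gives \<open>h = f\<close>. The two inequalities together are the isometry.

  For Paley-Wiener, Cauchy's formula over a horizontal line of height \<open>a\<close> reads
  \<open>F(z + \<i>a) = (1/2\<pi>\<i>) \<integral> F(s + \<i>a) / (s - z) ds\<close> (\<open>Cauchy_formula_upper_half_plane\<close>). It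
  comes from rectangles: the integral of \<open>|F|\<^sup>2\<close> over the vertical sides stays bounded along
  suitable positions of these sides, where the kernel tends to zero, and the top side disappears by the Cauchy-Schwarz inequality. Since
  \<open>\<i> / (z - s)\<close> is the integral of \<open>exp(\<i>(z - s)t)\<close> over \<open>t > 0\<close>, Fubini exhibits the right side
  as \<open>T f\<close>, where \<open>f\<close> is the inverse Fourier transform of \<open>s \<mapsto> F(s + \<i>a)\<close> restricted to
  \<open>t > 0\<close>. This inverse transform is the \<open>L\<^sup>2\<close> limit of those of the truncations of \<open>F(\<cdot> + \<i>a)\<close>;
  Bessel's inequality makes them a Cauchy sequence and supplies the constant. By injectivity,
  \<open>exp(at) f(t)\<close> does not depend on \<open>a\<close>, and \<open>a \<longlonglongrightarrow> 0\<close> gives the theorem.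
\<close>

section \<open>Bessel's inequality for the Fourier transform\<close>

lemma fubini_bounded_kernel:
  fixes a b :: "real \<Rightarrow> complex" and \<phi> :: "real \<Rightarrow> real \<Rightarrow> complex"
  assumes a: "integrable lborel a" and b: "integrable lborel b"
    and m[measurable]: "case_prod \<phi> \<in> borel_measurable (lborel \<Otimes>\<^sub>M lborel)"
    and le: "\<And>x t. cmod (\<phi> x t) \<le> 1"
  shows "(LINT x|lborel. LINT t|lborel. a x * b t * \<phi> x t)
       = (LINT t|lborel. LINT x|lborel. a x * b t * \<phi> x t)"
proof -
  have [measurable]: "a \<in> borel_measurable lborel" "b \<in> borel_measurable lborel"
    using a b by auto
  have 1: "integrable (lborel \<Otimes>\<^sub>M lborel) (\<lambda>(x, t). a x * b t)"
  proof (rule lborel_pair.Fubini_integrable)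
    have "integrable lborel (\<lambda>x. cmod (a x) * (LINT t|lborel. cmod (b t)))"
      using a by (intro integrable_mult_left) auto
    then show "integrable lborel (\<lambda>x. LINT y|lborel. norm (case (x, y) of (x, t) \<Rightarrow> a x * b t))"
      by (simp add: norm_mult)
  qed (use b in \<open>auto intro!: AE_I2\<close>)
  have 2: "integrable (lborel \<Otimes>\<^sub>M lborel) (\<lambda>(x, t). a x * b t * \<phi> x t)"
    by (rule Bochner_Integration.integrable_bound[OF 1])
       (auto intro!: AE_I2 mult_left_le simp: norm_mult le split: prod.split)
  show ?thesis
    using lborel_pair.Fubini_integral[OF 2] by simp
qed

lemma norm_integral_le_nn_integral:
  fixes f :: "'a \<Rightarrow> 'b::{banach, second_countable_topology}"
  shows "ennreal (norm (integral\<^sup>L M f)) \<le> (\<integral>\<^sup>+x. ennreal (norm (f x)) \<partial>M)"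
  by (cases "integrable M f") (simp_all add: integral_norm_bound_ennreal not_integrable_integral_eq)

text \<open>The characteristic function of the standard normal distribution, rescaled.\<close>

lemma gaussian_fourier:
  fixes e u :: real
  assumes e: "e > 0"
  shows "integrable lborel (\<lambda>x. exp (- (e * x)\<^sup>2 / 2))" (is ?A)
    and "(LINT x|lborel. complex_of_real (exp (- (e * x)\<^sup>2 / 2)) * exp (\<i> * of_real x * of_real u))
       = of_real (2 * pi * normal_density 0 e u)" (is ?B)
proof -
  have n: "exp (- (e * x)\<^sup>2 / 2) = sqrt (2 * pi) * std_normal_density (0 + e * x)" for x
    by (simp add: normal_density_def)
  have "integrable lborel (\<lambda>x. std_normal_density (0 + e * x))"
    using e by (subst lborel_integrable_real_affine_iff) auto
  then show ?A unfolding n by simp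
  have "complex_of_real (exp (- ((u / e)\<^sup>2) / 2)) = char std_normal_distribution (u / e)"
    by (simp add: char_std_normal_distribution)
  also have "\<dots> = (LINT x|lborel. of_real (std_normal_density x) * exp (\<i> * of_real (u / e * x)))"
    unfolding char_def by (subst integral_density) (auto simp: scaleR_conv_of_real)
  also have "\<dots> = e *\<^sub>R (LINT x|lborel. of_real (std_normal_density (0 + e * x)) * exp (\<i> * of_real (u / e * (0 + e * x))))"
    using e by (subst lborel_integral_real_affine[where c = e and t = 0]) auto
  also have "(\<lambda>x. of_real (std_normal_density (0 + e * x)) * exp (\<i> * complex_of_real (u / e * (0 + e * x)))) 
    = (\<lambda>x. of_real (std_normal_density (0 + e * x)) * exp (\<i> * of_real x * of_real u))"
    using e by (simp add: ac_simps fun_eq_iff)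
  finally have *: "complex_of_real (exp (- ((u / e)\<^sup>2) / 2)) =
     e *\<^sub>R (LINT x|lborel. of_real (std_normal_density (0 + e * x)) * exp (\<i> * of_real x * of_real u))" .
  have "(LINT x|lborel. complex_of_real (exp (- (e * x)\<^sup>2 / 2)) * exp (\<i> * of_real x * of_real u))
     = of_real (sqrt (2 * pi)) * (LINT x|lborel. of_real (std_normal_density (0 + e * x)) * exp (\<i> * of_real x * of_real u))"
    unfolding n of_real_mult mult.assoc by simp
  also have "\<dots> = of_real (sqrt (2 * pi) / e * exp (- ((u / e)\<^sup>2) / 2))"
    using e unfolding of_real_mult * by (simp add: scaleR_conv_of_real)
  also have "sqrt (2 * pi) / e * exp (- ((u / e)\<^sup>2) / 2) = 2 * pi * normal_density 0 e u"
  proof -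
    have "sqrt (2 * pi) * sqrt (2 * pi) = 2 * pi" by simp
    then show ?thesis
    using e by (simp add: normal_density_def real_sqrt_mult power_divide field_simps)
  qed
  finally show ?B .
qed

lemma borel_measurable_cnj [measurable]:
  "f \<in> borel_measurable M \<Longrightarrow> (\<lambda>x. cnj (f x)) \<in> borel_measurable M"
  by (rule borel_measurable_continuous_on[of cnj]) (auto intro: continuous_intros)

text \<open>At real arguments this is the Fourier transform on the line; for functions that vanish on
  \<open>(-\<infinity>, 0]\<close>, its values on the upper half-plane are those of the holomorphic Fourier transform.\<close>

definition fourier :: "(real \<Rightarrow> complex) \<Rightarrow> complex \<Rightarrow> complex" where
  "fourier g z = (LINT t|lborel. g t * exp (\<i> * z * of_real t))"

lemma fourier_measurable [measurable]:
  assumes [measurable]: "g \<in> borel_measurable borel"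
  shows "(\<lambda>x::real. fourier g (of_real x)) \<in> borel_measurable borel"
proof -
  have "(\<lambda>(x, t). g t * exp (\<i> * of_real x * of_real t)) \<in> borel_measurable (borel \<Otimes>\<^sub>M borel)"
    by measurable
  then have "(\<lambda>(x, t). g t * exp (\<i> * of_real x * of_real t)) \<in> borel_measurable (borel \<Otimes>\<^sub>M lborel)"
    by (simp cong: measurable_cong_sets sets_pair_measure_cong)
  then show ?thesis
    unfolding fourier_def[abs_def] by (rule lborel.borel_measurable_lebesgue_integral)
qed

lemma norm_fourier_le: "cmod (fourier g (of_real x)) \<le> (LINT t|lborel. cmod (g t))"
  unfolding fourier_def by (rule order_trans[OF integral_norm_bound]) (simp add: norm_mult)

text \<open>With the Gaussian weight everything is absolutely integrable, so two applications of Fubini turn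
  the left side into \<open>2\<pi> \<integral>\<integral> g(s) cnj (g(t)) N(s - t) dt ds\<close> with the normal density \<open>N\<close>.
  Since \<open>2|g(s)||g(t)| \<le> |g(s)|\<^sup>2 + |g(t)|\<^sup>2\<close> and \<open>N\<close> has mass one in either variable, this is
  at most \<open>2\<pi> \<integral>|g|\<^sup>2\<close>.\<close>

lemma fourier_gaussian_le:
  assumes g: "integrable lborel g" and e: "e > 0"
  shows "(\<integral>\<^sup>+x. ennreal ((cmod (fourier g (of_real x)))\<^sup>2 * exp (- (e * x)\<^sup>2 / 2)) \<partial>lborel)
     \<le> ennreal (2 * pi) * (\<integral>\<^sup>+t. ennreal ((cmod (g t))\<^sup>2) \<partial>lborel)" (is "?L \<le> ?R")
proof -
  define k where "k x = complex_of_real (exp (- (e * x)\<^sup>2 / 2))" for x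
  define N where "N = normal_density 0 e"
  have [measurable]: "g \<in> borel_measurable borel" using g by auto
  have [measurable]: "k \<in> borel_measurable borel" unfolding k_def by measurable
  have [measurable]: "N \<in> borel_measurable borel" unfolding N_def by measurable
  have N0: "N x \<ge> 0" for x by (simp add: N_def)
  have k: "integrable lborel k"
    unfolding k_def by (intro integrable_of_real gaussian_fourier e)
  have a: "integrable lborel (\<lambda>x. cnj (fourier g (of_real x)) * k x)"
  proof (rule Bochner_Integration.integrable_bound)
    show "integrable lborel (\<lambda>x. (LINT t|lborel. cmod (g t)) * cmod (k x))"
      using k by auto
    show "AE x in lborel. norm (cnj (fourier g (of_real x)) * k x) \<le> norm ((LINT t|lborel. cmod (g t)) * cmod (k x))"
      using norm_fourier_le[of g] by (auto simp: norm_mult intro!: mult_right_mono AE_I2)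
  qed simp
  have inner: "(LINT x|lborel. cnj (fourier g (of_real x)) * k x * exp (\<i> * of_real x * of_real s))
      = (LINT t|lborel. cnj (g t) * of_real (2 * pi * N (s - t)))" for s
  proof -
    have "(LINT x|lborel. cnj (fourier g (of_real x)) * k x * exp (\<i> * of_real x * of_real s))
      = (LINT x|lborel. LINT t|lborel. k x * cnj (g t) * exp (\<i> * of_real x * of_real (s - t)))"
    proof (rule Bochner_Integration.integral_cong[OF refl])
      fix x
      have "cnj (fourier g (of_real x)) = (LINT t|lborel. cnj (g t * exp (\<i> * of_real x * of_real t)))"
        unfolding fourier_def by (rule Bochner_Integration.integral_cnj[symmetric])
      also have "\<dots> * (k x * exp (\<i> * of_real x * of_real s))
         = (LINT t|lborel. cnj (g t * exp (\<i> * of_real x * of_real t)) * (k x * exp (\<i> * of_real x * of_real s)))"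
        by (rule integral_mult_left_zero[symmetric])
      also have "\<dots> = (LINT t|lborel. k x * cnj (g t) * exp (\<i> * of_real x * of_real (s - t)))"
        by (simp add: exp_cnj algebra_simps exp_add[symmetric] flip: exp_minus exp_add)
      finally show "cnj (fourier g (of_real x)) * k x * exp (\<i> * of_real x * of_real s) = \<dots>"
        by (simp add: mult.assoc)
    qed
    also have "\<dots> = (LINT t|lborel. LINT x|lborel. k x * cnj (g t) * exp (\<i> * of_real x * of_real (s - t)))"
      using k g by (intro fubini_bounded_kernel) auto
    also have "\<dots> = (LINT t|lborel. cnj (g t) * (LINT x|lborel. k x * exp (\<i> * of_real x * of_real (s - t))))"
      by (simp add: mult_ac flip: integral_mult_right_zero)
    also have "\<dots> = (LINT t|lborel. cnj (g t) * of_real (2 * pi * N (s - t)))"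
      unfolding k_def N_def gaussian_fourier(2)[OF e] ..
    finally show ?thesis .
  qed
  \<comment> \<open>The integral of \<open>|\<g>|\<^sup>2\<close> against the weight \<open>k\<close>, with one of the two transforms written out.\<close>
  define J where "J = (LINT x|lborel. LINT s|lborel. (cnj (fourier g (of_real x)) * k x) * g s * exp (\<i> * of_real x * of_real s))"
  have J1: "J = (LINT x|lborel. cnj (fourier g (of_real x)) * k x * fourier g (of_real x))"
    unfolding J_def mult.assoc[of _ "g _"] by (simp add: fourier_def)
  have J2: "J = (LINT s|lborel. g s * (LINT t|lborel. cnj (g t) * of_real (2 * pi * N (s - t))))"
  proof -
    have "J = (LINT s|lborel. LINT x|lborel. (cnj (fourier g (of_real x)) * k x) * g s * exp (\<i> * of_real x * of_real s))"
      unfolding J_def using a g by (intro fubini_bounded_kernel) auto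
    also have "\<dots> = (LINT s|lborel. LINT x|lborel. g s * (cnj (fourier g (of_real x)) * k x * exp (\<i> * of_real x * of_real s)))"
      by (simp only: mult_ac)
    finally show ?thesis
      by (simp only: integral_mult_right_zero inner)
  qed
  have "?L = (\<integral>\<^sup>+x. ennreal (cmod (cnj (fourier g (of_real x)) * k x * fourier g (of_real x))) \<partial>lborel)"
    by (simp add: k_def norm_mult power2_eq_square mult_ac)
  also have "\<dots> = ennreal (LINT x|lborel. cmod (cnj (fourier g (of_real x)) * k x * fourier g (of_real x)))"
  proof (rule nn_integral_eq_integral)
    show "integrable lborel (\<lambda>x. cmod (cnj (fourier g (of_real x)) * k x * fourier g (of_real x)))"
    proof (rule Bochner_Integration.integrable_bound)
      show "integrable lborel (\<lambda>x. (LINT t|lborel. cmod (g t)) * cmod (cnj (fourier g (of_real x)) * k x))"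
        using a by auto
      show "AE x in lborel. norm (cmod (cnj (fourier g (of_real x)) * k x * fourier g (of_real x))) \<le> norm ((LINT t|lborel. cmod (g t)) * cmod (cnj (fourier g (of_real x)) * k x))"
        using norm_fourier_le[of g] by (auto simp: norm_mult mult_ac intro!: mult_left_mono AE_I2)
    qed simp
  qed auto
  also have "(LINT x|lborel. cmod (cnj (fourier g (of_real x)) * k x * fourier g (of_real x))) = cmod J"
  proof -
    have "cnj (fourier g (of_real x)) * k x * fourier g (of_real x) = of_real (cmod (cnj (fourier g (of_real x)) * k x * fourier g (of_real x)))" for x
      by (simp add: norm_mult k_def complex_norm_square[symmetric] mult_ac flip: power2_eq_square)
    then have "J = of_real (LINT x|lborel. cmod (cnj (fourier g (of_real x)) * k x * fourier g (of_real x)))"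
      unfolding J1 integral_complex_of_real[symmetric] by simp
    then show ?thesis by (simp add: integral_nonneg_AE)
  qed
  finally have L: "?L = ennreal (cmod J)" .
  have mass: "(\<integral>\<^sup>+t. ennreal (pi * N (a + c * t)) \<partial>lborel) = ennreal pi" if "\<bar>c\<bar> = 1" for a c
  proof -
    have "(\<integral>\<^sup>+t. ennreal (N t) \<partial>lborel) = 1"
      unfolding N_def using e by (simp add: nn_integral_eq_integral)
    then have "ennreal \<bar>c\<bar> * (\<integral>\<^sup>+t. ennreal (N (a + c * t)) \<partial>lborel) = 1"
      using that by (subst nn_integral_real_affine[symmetric]) auto
    then show ?thesis
      using that N0 by (simp add: ennreal_mult nn_integral_cmult)
  qed
  have "ennreal (cmod J) \<le> (\<integral>\<^sup>+s. ennreal (cmod (g s * (LINT t|lborel. cnj (g t) * of_real (2 * pi * N (s - t))))) \<partial>lborel)"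
    unfolding J2 by (rule norm_integral_le_nn_integral)
  also have "\<dots> \<le> (\<integral>\<^sup>+s. (\<integral>\<^sup>+t. ennreal (pi * N (s - t)) * ennreal ((cmod (g s))\<^sup>2) + ennreal (pi * N (s - t)) * ennreal ((cmod (g t))\<^sup>2) \<partial>lborel) \<partial>lborel)"
  proof (intro nn_integral_mono)
    fix s
    have "ennreal (cmod (g s * (LINT t|lborel. cnj (g t) * of_real (2 * pi * N (s - t)))))
        = ennreal (cmod (LINT t|lborel. g s * (cnj (g t) * of_real (2 * pi * N (s - t)))))"
      by simp
    also have "\<dots> \<le> (\<integral>\<^sup>+t. ennreal (cmod (g s * (cnj (g t) * of_real (2 * pi * N (s - t))))) \<partial>lborel)"
      by (rule norm_integral_le_nn_integral)
    also have "\<dots> \<le> (\<integral>\<^sup>+t. ennreal (pi * N (s - t)) * ennreal ((cmod (g s))\<^sup>2) + ennreal (pi * N (s - t)) * ennreal ((cmod (g t))\<^sup>2) \<partial>lborel)"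
    proof (intro nn_integral_mono)
      fix t
      have "cmod (g s * (cnj (g t) * of_real (2 * pi * N (s - t)))) = (pi * N (s - t)) * (2 * cmod (g s) * cmod (g t))"
        using N0[of "s - t"] by (simp add: norm_mult)
      also have "\<dots> \<le> (pi * N (s - t)) * ((cmod (g s))\<^sup>2 + (cmod (g t))\<^sup>2)"
        using N0[of "s - t"] by (intro mult_left_mono sum_squares_bound) auto
      finally show "ennreal (cmod (g s * (cnj (g t) * of_real (2 * pi * N (s - t)))))
        \<le> ennreal (pi * N (s - t)) * ennreal ((cmod (g s))\<^sup>2) + ennreal (pi * N (s - t)) * ennreal ((cmod (g t))\<^sup>2)"
        using N0[of "s - t"] by (simp add: algebra_simps ennreal_leI flip: ennreal_mult ennreal_plus)
    qed
    finally show "ennreal (cmod (g s * (LINT t|lborel. cnj (g t) * of_real (2 * pi * N (s - t)))))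
       \<le> (\<integral>\<^sup>+t. ennreal (pi * N (s - t)) * ennreal ((cmod (g s))\<^sup>2) + ennreal (pi * N (s - t)) * ennreal ((cmod (g t))\<^sup>2) \<partial>lborel)" .
  qed
  also have "\<dots> = (\<integral>\<^sup>+s. (\<integral>\<^sup>+t. ennreal (pi * N (s - t)) * ennreal ((cmod (g s))\<^sup>2) \<partial>lborel) \<partial>lborel)
      + (\<integral>\<^sup>+s. (\<integral>\<^sup>+t. ennreal (pi * N (s - t)) * ennreal ((cmod (g t))\<^sup>2) \<partial>lborel) \<partial>lborel)"
    by (subst nn_integral_add[symmetric]) (auto simp: nn_integral_add)
  also have "(\<integral>\<^sup>+s. (\<integral>\<^sup>+t. ennreal (pi * N (s - t)) * ennreal ((cmod (g t))\<^sup>2) \<partial>lborel) \<partial>lborel)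
     = (\<integral>\<^sup>+t. (\<integral>\<^sup>+s. ennreal (pi * N (s - t)) * ennreal ((cmod (g t))\<^sup>2) \<partial>lborel) \<partial>lborel)"
    by (rule lborel_pair.Fubini'[symmetric]) simp
  also have "\<dots> = (\<integral>\<^sup>+t. ennreal pi * ennreal ((cmod (g t))\<^sup>2) \<partial>lborel)"
  proof (intro nn_integral_cong)
    fix t
    show "(\<integral>\<^sup>+s. ennreal (pi * N (s - t)) * ennreal ((cmod (g t))\<^sup>2) \<partial>lborel) = ennreal pi * ennreal ((cmod (g t))\<^sup>2)"
      using mass[where a = "-t" and c = 1] by (simp add: nn_integral_multc)
  qed
  also have "(\<integral>\<^sup>+s. (\<integral>\<^sup>+t. ennreal (pi * N (s - t)) * ennreal ((cmod (g s))\<^sup>2) \<partial>lborel) \<partial>lborel)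
     = (\<integral>\<^sup>+t. ennreal pi * ennreal ((cmod (g t))\<^sup>2) \<partial>lborel)"
  proof (intro nn_integral_cong)
    fix t
    show "(\<integral>\<^sup>+s. ennreal (pi * N (t - s)) * ennreal ((cmod (g t))\<^sup>2) \<partial>lborel) = ennreal pi * ennreal ((cmod (g t))\<^sup>2)"
      using mass[where a = t and c = "-1"] by (simp add: nn_integral_multc)
  qed
  also have "(\<integral>\<^sup>+t. ennreal pi * ennreal ((cmod (g t))\<^sup>2) \<partial>lborel) + (\<integral>\<^sup>+t. ennreal pi * ennreal ((cmod (g t))\<^sup>2) \<partial>lborel) = ?R"
    by (simp add: nn_integral_cmult flip: distrib_right ennreal_plus)
  finally show ?thesis unfolding L .
qed

text \<open>Fatou's lemma, as the Gaussian weights tend to one.\<close>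

theorem fourier_bessel:
  assumes g: "integrable lborel g"
  shows "(\<integral>\<^sup>+x. ennreal ((cmod (fourier g (of_real x)))\<^sup>2) \<partial>lborel)
     \<le> ennreal (2 * pi) * (\<integral>\<^sup>+t. ennreal ((cmod (g t))\<^sup>2) \<partial>lborel)"
proof -
  have [measurable]: "g \<in> borel_measurable borel" using g by auto
  \<comment> \<open>Any positive sequence that tends to zero will do.\<close>
  define e where "e n = inverse (real (Suc n))" for n
  have e: "e n > 0" for n by (simp add: e_def)
  have e0: "e \<longlonglongrightarrow> 0" unfolding e_def by (rule LIMSEQ_inverse_real_of_nat)
  have "(\<integral>\<^sup>+x. ennreal ((cmod (fourier g (of_real x)))\<^sup>2) \<partial>lborel)
     = (\<integral>\<^sup>+x. liminf (\<lambda>n. ennreal ((cmod (fourier g (of_real x)))\<^sup>2 * exp (- (e n * x)\<^sup>2 / 2))) \<partial>lborel)"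
  proof (rule nn_integral_cong)
    fix x
    have "(\<lambda>n. (cmod (fourier g (of_real x)))\<^sup>2 * exp (- (e n * x)\<^sup>2 / 2)) \<longlonglongrightarrow> (cmod (fourier g (of_real x)))\<^sup>2 * exp (- (0 * x)\<^sup>2 / 2)"
      by (intro tendsto_intros e0) auto
    then have "(\<lambda>n. ennreal ((cmod (fourier g (of_real x)))\<^sup>2 * exp (- (e n * x)\<^sup>2 / 2))) \<longlonglongrightarrow> ennreal ((cmod (fourier g (of_real x)))\<^sup>2)"
      by (intro tendsto_ennrealI) simp
    then show "ennreal ((cmod (fourier g (of_real x)))\<^sup>2) = liminf (\<lambda>n. ennreal ((cmod (fourier g (of_real x)))\<^sup>2 * exp (- (e n * x)\<^sup>2 / 2)))"
      by (intro lim_imp_Liminf[symmetric]) auto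
  qed
  also have "\<dots> \<le> liminf (\<lambda>n. \<integral>\<^sup>+x. ennreal ((cmod (fourier g (of_real x)))\<^sup>2 * exp (- (e n * x)\<^sup>2 / 2)) \<partial>lborel)"
    by (rule nn_integral_liminf) simp
  also have "\<dots> \<le> ennreal (2 * pi) * (\<integral>\<^sup>+t. ennreal ((cmod (g t))\<^sup>2) \<partial>lborel)"
    by (rule Liminf_le, simp) (intro always_eventually allI fourier_gaussian_le g e)
  finally show ?thesis .
qed

section \<open>Injectivity of the Fourier transform\<close>

text \<open>The positive and the negative part of \<open>h\<close> have the same transform, in particular (at \<open>0\<close>) the
  same mass. Normalised, they are densities of probability measures with equal characteristic
  functions, hence equal almost everywhere; but at most one of them is nonzero at each point.\<close>

lemma fourier_of_real_eq_0:
  fixes h :: "real \<Rightarrow> real"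
  assumes h: "integrable lborel h" and 0: "\<And>x. fourier (\<lambda>t. of_real (h t)) (of_real x) = 0"
  shows "AE t in lborel. h t = 0"
proof -
  define P Q where "P t = max 0 (h t)" and "Q t = max 0 (- h t)" for t
  have hPQ: "h t = P t - Q t" for t by (auto simp: P_def Q_def)
  have iP: "integrable lborel P" and iQ: "integrable lborel Q"
    unfolding P_def[abs_def] Q_def[abs_def] using h by auto
  have [measurable]: "P \<in> borel_measurable borel" "Q \<in> borel_measurable borel"
    using iP iQ by auto
  have P0: "P t \<ge> 0" and Q0: "Q t \<ge> 0" for t by (auto simp: P_def Q_def)
  have integ: "integrable lborel (\<lambda>t. complex_of_real (p t) * exp (\<i> * of_real x * of_real t))"
    if "integrable lborel p" for p x
    using that by (intro Bochner_Integration.integrable_bound[OF that]) (auto simp: norm_mult)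
  have eq: "fourier (\<lambda>t. of_real (P t)) (of_real x) = fourier (\<lambda>t. of_real (Q t)) (of_real x)" for x
  proof -
    have "0 = (LINT t|lborel. complex_of_real (P t) * exp (\<i> * of_real x * of_real t)
        - of_real (Q t) * exp (\<i> * of_real x * of_real t))"
      using 0[of x] unfolding fourier_def hPQ of_real_diff left_diff_distrib by simp
    also have "\<dots> = fourier (\<lambda>t. of_real (P t)) (of_real x) - fourier (\<lambda>t. of_real (Q t)) (of_real x)"
      unfolding fourier_def by (rule Bochner_Integration.integral_diff[OF integ[OF iP] integ[OF iQ]])
    finally show ?thesis by simp
  qed
  define c where "c = (LINT t|lborel. P t)"
  have cQ: "c = (LINT t|lborel. Q t)"
  proof -
    have "complex_of_real c = of_real (LINT t|lborel. Q t)"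
      using eq[of 0] unfolding c_def by (simp add: fourier_def)
    then show ?thesis by (simp only: of_real_eq_iff)
  qed
  have c0: "c \<ge> 0" unfolding c_def using P0 by (simp add: integral_nonneg_AE)
  \<comment> \<open>Without mass there is no probability measure, but then both parts vanish.\<close>
  show ?thesis
  proof (cases "c = 0")
    case True
    have "AE t in lborel. P t = 0"
      using True c_def integral_nonneg_eq_0_iff_AE[OF iP] P0 by simp
    moreover have "AE t in lborel. Q t = 0"
      using True cQ integral_nonneg_eq_0_iff_AE[OF iQ] Q0 by simp
    ultimately show ?thesis by eventually_elim (simp add: hPQ)
  next
    case False
    with c0 have c: "c > 0" by simp
    have dist: "real_distribution (density lborel (\<lambda>t. ennreal (p t / c)))"
      and char: "char (density lborel (\<lambda>t. ennreal (p t / c))) x = fourier (\<lambda>t. of_real (p t)) (of_real x) / c"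
      if "integrable lborel p" "\<And>t. p t \<ge> 0" "(LINT t|lborel. p t) = c" for p x
    proof -
      have [measurable]: "p \<in> borel_measurable borel" using that by auto
      have "(\<integral>\<^sup>+ t. ennreal (p t / c) \<partial>lborel) = 1"
        using that c by (subst nn_integral_eq_integral) auto
      then have "prob_space (density lborel (\<lambda>t. ennreal (p t / c)))"
        by (intro prob_spaceI) (simp add: emeasure_density)
      then show "real_distribution (density lborel (\<lambda>t. ennreal (p t / c)))"
        by (simp add: real_distribution_def real_distribution_axioms_def)
      show "char (density lborel (\<lambda>t. ennreal (p t / c))) x = fourier (\<lambda>t. of_real (p t)) (of_real x) / c"
        unfolding char_def using that c
        by (subst integral_density) (auto simp: scaleR_conv_of_real fourier_def mult.assoc)
    qed
    have "density lborel (\<lambda>t. ennreal (P t / c)) = density lborel (\<lambda>t. ennreal (Q t / c))"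
    proof (rule Levy_uniqueness)
      show "char (density lborel (\<lambda>t. ennreal (P t / c))) = char (density lborel (\<lambda>t. ennreal (Q t / c)))"
        unfolding char[OF iP P0 c_def[symmetric]] char[OF iQ Q0 cQ[symmetric]] fun_eq_iff eq by simp
    qed (fact dist[OF iP P0 c_def[symmetric]] dist[OF iQ Q0 cQ[symmetric]])+
    then have "AE t in lborel. ennreal (P t / c) = ennreal (Q t / c)"
      by (intro sigma_finite_measure.density_unique[OF sigma_finite_lborel]) auto
    then show ?thesis
      by eventually_elim (use c P0 Q0 in \<open>auto simp: hPQ\<close>)
  qed
qed

text \<open>The transform of \<open>cnj \<circ> g\<close> is \<open>x \<mapsto> cnj (\<g>(-x))\<close>, where \<open>\<g>\<close> is the transform of \<open>g\<close>, so the
  real and the imaginary part of \<open>g\<close> have vanishing transforms as well.\<close>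

theorem fourier_injective:
  assumes g: "integrable lborel g" and 0: "\<And>x. fourier g (of_real x) = 0"
  shows "AE t in lborel. g t = 0"
proof -
  have cnj0: "fourier (\<lambda>t. cnj (g t)) (of_real x) = 0" for x
  proof -
    have "fourier (\<lambda>t. cnj (g t)) (of_real x) = (LINT t|lborel. cnj (g t * exp (\<i> * of_real (- x) * of_real t)))"
      unfolding fourier_def by (simp add: exp_cnj)
    also have "\<dots> = cnj (fourier g (of_real (- x)))"
      unfolding fourier_def by (rule Bochner_Integration.integral_cnj)
    finally show ?thesis using 0[of "- x"] by simp
  qed
  have integ: "integrable lborel (\<lambda>t. p t * exp (\<i> * of_real x * of_real t))"
    if "integrable lborel p" for p x
    using that by (intro Bochner_Integration.integrable_bound[OF that]) (auto simp: norm_mult)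
  have lin: "fourier (\<lambda>t. a * g t + b * cnj (g t)) (of_real x) = 0" for a b x
  proof -
    have "fourier (\<lambda>t. a * g t + b * cnj (g t)) (of_real x)
      = (LINT t|lborel. a * (g t * exp (\<i> * of_real x * of_real t)) + b * (cnj (g t) * exp (\<i> * of_real x * of_real t)))"
      unfolding fourier_def by (simp add: algebra_simps)
    also have "\<dots> = a * fourier g (of_real x) + b * fourier (\<lambda>t. cnj (g t)) (of_real x)"
      unfolding fourier_def using g
      by (subst Bochner_Integration.integral_add) (auto intro!: integ integrable_mult_right)
    finally show ?thesis by (simp add: 0 cnj0)
  qed
  have re: "complex_of_real (Re z) = 1/2 * z + 1/2 * cnj z" for z
    by (simp add: complex_eq_iff)
  have im: "complex_of_real (Im z) = (- \<i>/2) * z + (\<i>/2) * cnj z" for z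
    by (simp add: complex_eq_iff)
  have "AE t in lborel. Re (g t) = 0"
    by (rule fourier_of_real_eq_0) (use g in \<open>auto simp only: re lin integrable_Re\<close>)
  moreover have "AE t in lborel. Im (g t) = 0"
    by (rule fourier_of_real_eq_0) (use g in \<open>auto simp only: im lin integrable_Im\<close>)
  ultimately show ?thesis
    by eventually_elim (simp add: complex_eq_iff)
qed

section \<open>Square-integrable functions\<close>

text \<open>The Cauchy-Schwarz inequality, stated with upper bounds \<open>A\<close> and \<open>B\<close>. It follows from
  \<open>2|f||g| \<le> l|f|\<^sup>2 + |g|\<^sup>2/l\<close>, integrated with the best weight \<open>l\<close>; keeping the bounds positive
  avoids the case in which no best weight exists.\<close>

lemma product_of_square_integrable:
  fixes f g :: "'a \<Rightarrow> complex"
  assumes [measurable]: "f \<in> borel_measurable M" "g \<in> borel_measurable M"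
    and f: "(\<integral>\<^sup>+x. ennreal ((cmod (f x))\<^sup>2) \<partial>M) \<le> ennreal A" and A: "A > 0"
    and g: "(\<integral>\<^sup>+x. ennreal ((cmod (g x))\<^sup>2) \<partial>M) \<le> ennreal B" and B: "B > 0"
  shows "integrable M (\<lambda>x. f x * g x)"
    and "cmod (LINT x|M. f x * g x) \<le> sqrt (A * B)"
proof -
  \<comment> \<open>This weight makes \<open>l A\<close> and \<open>B / l\<close> equal.\<close>
  define l where "l = sqrt (B / A)"
  have l: "l > 0" using A B by (simp add: l_def)
  have "(\<integral>\<^sup>+x. ennreal (cmod (f x * g x)) \<partial>M)
     \<le> (\<integral>\<^sup>+x. ennreal (l / 2) * ennreal ((cmod (f x))\<^sup>2) + ennreal (1 / (2 * l)) * ennreal ((cmod (g x))\<^sup>2) \<partial>M)"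
  proof (rule nn_integral_mono)
    fix x
    have "0 \<le> (l * cmod (f x) - cmod (g x))\<^sup>2" by simp
    then have "2 * l * (cmod (f x) * cmod (g x)) \<le> l\<^sup>2 * (cmod (f x))\<^sup>2 + (cmod (g x))\<^sup>2"
      by (simp add: power2_eq_square algebra_simps)
    then have "cmod (f x) * cmod (g x) \<le> (l\<^sup>2 * (cmod (f x))\<^sup>2 + (cmod (g x))\<^sup>2) / (2 * l)"
      using l by (simp add: field_simps)
    also have "\<dots> = l / 2 * (cmod (f x))\<^sup>2 + 1 / (2 * l) * (cmod (g x))\<^sup>2"
      using l by (simp add: field_simps power2_eq_square)
    finally show "ennreal (cmod (f x * g x)) \<le> ennreal (l / 2) * ennreal ((cmod (f x))\<^sup>2) + ennreal (1 / (2 * l)) * ennreal ((cmod (g x))\<^sup>2)"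
      using l by (simp add: norm_mult ennreal_leI flip: ennreal_mult ennreal_plus)
  qed
  also have "\<dots> = ennreal (l / 2) * (\<integral>\<^sup>+x. ennreal ((cmod (f x))\<^sup>2) \<partial>M) + ennreal (1 / (2 * l)) * (\<integral>\<^sup>+x. ennreal ((cmod (g x))\<^sup>2) \<partial>M)"
    by (simp add: nn_integral_add nn_integral_cmult)
  also have "\<dots> \<le> ennreal (l / 2) * ennreal A + ennreal (1 / (2 * l)) * ennreal B"
    by (intro add_mono mult_left_mono f g) auto
  also have "\<dots> = ennreal (l / 2 * A + 1 / (2 * l) * B)"
    using A B l by (simp flip: ennreal_mult ennreal_plus)
  also have "l / 2 * A + 1 / (2 * l) * B = sqrt (A * B)"
  proof -
    have "sqrt A * sqrt A = A" "sqrt B * sqrt B = B" using A B by auto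
    then show ?thesis
      using A B unfolding l_def
      by (simp add: real_sqrt_divide real_sqrt_mult field_simps)
  qed
  finally have *: "(\<integral>\<^sup>+x. ennreal (cmod (f x * g x)) \<partial>M) \<le> ennreal (sqrt (A * B))" .
  then show int: "integrable M (\<lambda>x. f x * g x)"
    by (intro integrableI_bounded) (auto intro: le_less_trans)
  show "cmod (LINT x|M. f x * g x) \<le> sqrt (A * B)"
    using order_trans[OF integral_norm_bound_ennreal[OF int] *] A B by (simp add: ennreal_le_iff)
qed

text \<open>Completeness of \<open>L\<^sup>2\<close>, for sequences that converge at a geometric rate. The increments \<open>d\<^sub>n\<close>
  satisfy \<open>\<integral> \<Sum>\<^sub>n 2\<^sup>n |d\<^sub>n|\<^sup>2 < \<infinity>\<close>, so that \<open>|d\<^sub>n|\<close> decays like \<open>2\<close> to the power \<open>-n/2\<close> at almost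
  every point and the sequence converges there; Fatou transfers the rate to the limit.\<close>

lemma L2_complete:
  fixes f :: "nat \<Rightarrow> 'a \<Rightarrow> complex"
  assumes [measurable]: "\<And>n. f n \<in> borel_measurable M" and C: "C \<ge> 0"
    and cauchy: "\<And>m n. n \<le> m \<Longrightarrow> (\<integral>\<^sup>+x. ennreal ((cmod (f m x - f n x))\<^sup>2) \<partial>M) \<le> ennreal (C * (1 / 4) ^ n)"
  obtains g where "g \<in> borel_measurable M" "AE x in M. (\<lambda>n. f n x) \<longlonglongrightarrow> g x"
    "\<And>n. (\<integral>\<^sup>+x. ennreal ((cmod (g x - f n x))\<^sup>2) \<partial>M) \<le> ennreal (C * (1 / 4) ^ n)"
proof -
  define d where "d n x = f (Suc n) x - f n x" for n x
  have [measurable]: "d n \<in> borel_measurable M" for n unfolding d_def[abs_def] by measurable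
  define S where "S x = (\<Sum>n. ennreal (2 ^ n * (cmod (d n x))\<^sup>2))" for x
  have [measurable]: "S \<in> borel_measurable M" unfolding S_def[abs_def] by measurable
  have "(\<integral>\<^sup>+x. S x \<partial>M) = (\<Sum>n. \<integral>\<^sup>+x. ennreal (2 ^ n * (cmod (d n x))\<^sup>2) \<partial>M)"
    unfolding S_def by (rule nn_integral_suminf) measurable
  also have "\<dots> \<le> (\<Sum>n. ennreal (C * (1 / 2) ^ n))"
  proof (intro suminf_le summableI)
    fix n
    have "(\<integral>\<^sup>+x. ennreal (2 ^ n * (cmod (d n x))\<^sup>2) \<partial>M) = ennreal (2 ^ n) * (\<integral>\<^sup>+x. ennreal ((cmod (d n x))\<^sup>2) \<partial>M)"
      by (simp add: ennreal_mult nn_integral_cmult)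
    also have "\<dots> \<le> ennreal (2 ^ n) * ennreal (C * (1 / 4) ^ n)"
      unfolding d_def by (intro mult_left_mono cauchy) auto
    also have "\<dots> = ennreal (C * (2 * (1 / 4)) ^ n)"
      using C unfolding power_mult_distrib by (simp add: ac_simps flip: ennreal_mult)
    finally show "(\<integral>\<^sup>+x. ennreal (2 ^ n * (cmod (d n x))\<^sup>2) \<partial>M) \<le> ennreal (C * (1 / 2) ^ n)" by simp
  qed
  also have "\<dots> = ennreal (\<Sum>n. C * (1 / 2) ^ n)"
    using C by (intro suminf_ennreal2 summable_mult summable_geometric) auto
  finally have "(\<integral>\<^sup>+x. S x \<partial>M) \<noteq> \<infinity>" by (auto simp: top_unique)
  then have "AE x in M. S x \<noteq> \<infinity>"
    by (intro nn_integral_PInf_AE) auto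
  moreover have "convergent (\<lambda>n. f n x)" if "S x \<noteq> \<infinity>" for x
  proof -
    define s where "s = enn2real (S x)"
    have s: "S x = ennreal s" "s \<ge> 0"
      using that unfolding s_def by (simp_all add: less_top)
    have dle: "cmod (d n x) \<le> sqrt s * (sqrt (1 / 2)) ^ n" for n
    proof -
      have "sum (\<lambda>n. ennreal (2 ^ n * (cmod (d n x))\<^sup>2)) {n} \<le> S x"
        unfolding S_def by (intro sum_le_suminf summableI) auto
      then have "ennreal (2 ^ n * (cmod (d n x))\<^sup>2) \<le> ennreal s"
        unfolding s(1) by simp
      then have "2 ^ n * (cmod (d n x))\<^sup>2 \<le> s"
        using s(2) by (simp only: ennreal_le_iff)
      then have "(cmod (d n x))\<^sup>2 \<le> s * (1 / 2) ^ n"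
        by (simp add: field_simps)
      then have "cmod (d n x) \<le> sqrt (s * (1 / 2) ^ n)"
        by (rule real_le_rsqrt)
      then show ?thesis by (simp add: real_sqrt_mult real_sqrt_power)
    qed
    have "summable (\<lambda>n. sqrt s * (sqrt (1 / 2)) ^ n)"
      by (intro summable_mult summable_geometric) (simp add: real_sqrt_divide)
    then have "summable (\<lambda>n. d n x)"
      by (rule summable_comparison_test'[where N = 0]) (rule dle)
    then have "convergent (\<lambda>n. \<Sum>i<n. d i x)"
      by (simp add: summable_iff_convergent)
    moreover have "(\<Sum>i<n. d i x) = f n x - f 0 x" for n
      unfolding d_def by (rule sum_lessThan_telescope)
    ultimately have "convergent (\<lambda>n. (f n x - f 0 x) + f 0 x)"
      by (intro convergent_add convergent_const) simp
    then show ?thesis by simp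
  qed
  ultimately have lim: "AE x in M. (\<lambda>n. f n x) \<longlonglongrightarrow> lim (\<lambda>n. f n x)"
    by (auto simp: convergent_LIMSEQ_iff elim: eventually_mono)
  have [measurable]: "(\<lambda>x. lim (\<lambda>n. f n x)) \<in> borel_measurable M"
    by (rule borel_measurable_lim_metric) simp
  have "(\<integral>\<^sup>+x. ennreal ((cmod (lim (\<lambda>n. f n x) - f n x))\<^sup>2) \<partial>M) \<le> ennreal (C * (1 / 4) ^ n)" for n
  proof -
    have "(\<integral>\<^sup>+x. ennreal ((cmod (lim (\<lambda>n. f n x) - f n x))\<^sup>2) \<partial>M)
      = (\<integral>\<^sup>+x. liminf (\<lambda>m. ennreal ((cmod (f m x - f n x))\<^sup>2)) \<partial>M)"
    proof (rule nn_integral_cong_AE, use lim in eventually_elim)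
      case (elim x)
      then have "(\<lambda>m. ennreal ((cmod (f m x - f n x))\<^sup>2)) \<longlonglongrightarrow> ennreal ((cmod (lim (\<lambda>n. f n x) - f n x))\<^sup>2)"
        by (intro tendsto_ennrealI tendsto_intros)
      then show ?case by (intro lim_imp_Liminf[symmetric]) auto
    qed
    also have "\<dots> \<le> liminf (\<lambda>m. \<integral>\<^sup>+x. ennreal ((cmod (f m x - f n x))\<^sup>2) \<partial>M)"
      by (rule nn_integral_liminf) measurable
    also have "\<dots> \<le> ennreal (C * (1 / 4) ^ n)"
      by (rule Liminf_le, simp) (rule eventually_sequentiallyI[of n], rule cauchy)
    finally show ?thesis .
  qed
  with lim show ?thesis by (intro that) auto
qed

lemma L2_pairing_tendsto:
  fixes f :: "nat \<Rightarrow> 'a \<Rightarrow> complex"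
  assumes [measurable]: "\<And>n. f n \<in> borel_measurable M" "g \<in> borel_measurable M" "h \<in> borel_measurable M"
    and f: "\<And>n. integrable M (\<lambda>x. f n x * h x)" and g: "integrable M (\<lambda>x. g x * h x)"
    and C: "C > 0" and le: "\<And>n. (\<integral>\<^sup>+x. ennreal ((cmod (g x - f n x))\<^sup>2) \<partial>M) \<le> ennreal (C * (1 / 4) ^ n)"
    and B: "B > 0" and h: "(\<integral>\<^sup>+x. ennreal ((cmod (h x))\<^sup>2) \<partial>M) \<le> ennreal B"
  shows "(\<lambda>n. LINT x|M. f n x * h x) \<longlonglongrightarrow> (LINT x|M. g x * h x)"
proof -
  have "(\<lambda>n. (LINT x|M. g x * h x) - (LINT x|M. f n x * h x)) \<longlonglongrightarrow> 0"
  proof (rule Lim_null_comparison)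
    show "\<forall>\<^sub>F n in sequentially. norm ((LINT x|M. g x * h x) - (LINT x|M. f n x * h x)) \<le> sqrt (C * (1 / 4) ^ n * B)"
    proof (rule always_eventually, rule allI)
      fix n
      have "(LINT x|M. g x * h x) - (LINT x|M. f n x * h x) = (LINT x|M. (g x - f n x) * h x)"
        using f g by (simp add: left_diff_distrib)
      also have "cmod \<dots> \<le> sqrt (C * (1 / 4) ^ n * B)"
        using C B by (intro product_of_square_integrable(2) le h) auto
      finally show "norm ((LINT x|M. g x * h x) - (LINT x|M. f n x * h x)) \<le> sqrt (C * (1 / 4) ^ n * B)" .
    qed
    have "(\<lambda>n. sqrt (C * (1 / 4) ^ n * B)) \<longlonglongrightarrow> sqrt (C * 0 * B)"
      by (intro tendsto_intros LIMSEQ_power_zero) auto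
    then show "(\<lambda>n. sqrt (C * (1 / 4) ^ n * B)) \<longlonglongrightarrow> 0" by simp
  qed
  then have "(\<lambda>n. (LINT x|M. g x * h x) - ((LINT x|M. g x * h x) - (LINT x|M. f n x * h x))) \<longlonglongrightarrow> (LINT x|M. g x * h x) - 0"
    by (intro tendsto_intros)
  then show ?thesis by simp
qed

lemma small_tail:
  fixes F :: "real \<Rightarrow> complex"
  assumes [measurable]: "F \<in> borel_measurable borel"
    and fin: "(\<integral>\<^sup>+x. ennreal ((cmod (F x))\<^sup>2) \<partial>lborel) < \<infinity>" and e: "e > 0"
  obtains N :: nat where "(\<integral>\<^sup>+x. ennreal ((cmod (F x - indicator {- real N..real N} x *\<^sub>R F x))\<^sup>2) \<partial>lborel) \<le> ennreal e"
proof -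
  let ?G = "\<lambda>N x. F x - indicator {- real N..real N} x *\<^sub>R F x"
  have "(\<lambda>N. \<integral>\<^sup>+x. ennreal ((cmod (?G N x))\<^sup>2) \<partial>lborel) \<longlonglongrightarrow> (\<integral>\<^sup>+x. ennreal 0 \<partial>(lborel :: real measure))"
  proof (rule nn_integral_dominated_convergence[where w = "\<lambda>x. ennreal ((cmod (F x))\<^sup>2)"])
    show "AE x in lborel. (\<lambda>N. ennreal ((cmod (?G N x))\<^sup>2)) \<longlonglongrightarrow> ennreal 0"
    proof (rule AE_I2)
      fix x :: real
      have "\<forall>\<^sub>F N in sequentially. real N \<ge> \<bar>x\<bar>"
        by (rule eventually_sequentiallyI[of "nat \<lceil>\<bar>x\<bar>\<rceil>"]) linarith
      then have "\<forall>\<^sub>F N in sequentially. ennreal ((cmod (?G N x))\<^sup>2) = ennreal 0"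
        by eventually_elim (auto simp: indicator_def abs_le_iff)
      then show "(\<lambda>N. ennreal ((cmod (?G N x))\<^sup>2)) \<longlonglongrightarrow> ennreal 0"
        by (rule tendsto_eventually)
    qed
    show "AE x in lborel. ennreal ((cmod (?G N x))\<^sup>2) \<le> ennreal ((cmod (F x))\<^sup>2)" for N
      by (auto simp: indicator_def)
  qed (use fin in auto)
  then have "\<forall>\<^sub>F N in sequentially. (\<integral>\<^sup>+x. ennreal ((cmod (?G N x))\<^sup>2) \<partial>lborel) < ennreal e"
    using e by (intro order_tendstoD(2)) auto
  then show ?thesis using that by (meson eventually_happens less_imp_le sequentially_bot)
qed

lemma nn_integral_square_diff_le:
  fixes f g h :: "'a \<Rightarrow> complex"
  assumes [measurable]: "f \<in> borel_measurable M" "g \<in> borel_measurable M" "h \<in> borel_measurable M"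
  shows "(\<integral>\<^sup>+x. ennreal ((cmod (f x - g x))\<^sup>2) \<partial>M)
    \<le> 2 * ((\<integral>\<^sup>+x. ennreal ((cmod (h x - f x))\<^sup>2) \<partial>M) + (\<integral>\<^sup>+x. ennreal ((cmod (h x - g x))\<^sup>2) \<partial>M))"
proof -
  have "(\<integral>\<^sup>+x. ennreal ((cmod (f x - g x))\<^sup>2) \<partial>M) \<le> (\<integral>\<^sup>+x. 2 * (ennreal ((cmod (h x - f x))\<^sup>2) + ennreal ((cmod (h x - g x))\<^sup>2)) \<partial>M)"
  proof (rule nn_integral_mono)
    fix x
    have "cmod (f x - g x) \<le> cmod (h x - f x) + cmod (h x - g x)"
      using norm_triangle_ineq4[of "h x - g x" "h x - f x"] by simp
    then have "(cmod (f x - g x))\<^sup>2 \<le> (cmod (h x - f x) + cmod (h x - g x))\<^sup>2"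
      by (intro power_mono) auto
    also have "\<dots> \<le> 2 * ((cmod (h x - f x))\<^sup>2 + (cmod (h x - g x))\<^sup>2)"
      using sum_squares_bound[of "cmod (h x - f x)" "cmod (h x - g x)"] by (simp add: power2_sum)
    finally have "ennreal ((cmod (f x - g x))\<^sup>2) \<le> ennreal (2 * ((cmod (h x - f x))\<^sup>2 + (cmod (h x - g x))\<^sup>2))"
      by (rule ennreal_leI)
    also have "\<dots> = 2 * (ennreal ((cmod (h x - f x))\<^sup>2) + ennreal ((cmod (h x - g x))\<^sup>2))"
      by (simp add: ennreal_mult ennreal_plus)
    finally show "ennreal ((cmod (f x - g x))\<^sup>2) \<le> 2 * (ennreal ((cmod (h x - f x))\<^sup>2) + ennreal ((cmod (h x - g x))\<^sup>2))" .
  qed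
  also have "\<dots> = 2 * ((\<integral>\<^sup>+x. ennreal ((cmod (h x - f x))\<^sup>2) \<partial>M) + (\<integral>\<^sup>+x. ennreal ((cmod (h x - g x))\<^sup>2) \<partial>M))"
    by (simp add: nn_integral_cmult nn_integral_add)
  finally show ?thesis .
qed

section \<open>Cauchy's formula over a horizontal line\<close>

lemma contour_integral_linepath_same_Im:
  assumes "a < b"
  shows   "contour_integral (linepath (Complex a y) (Complex b y)) f = integral {a..b} (\<lambda>x. f (Complex x y))"
proof -
  have shift: "linepath (Complex a y) (Complex b y) t = linepath (of_real a) (of_real b) t + \<i> * of_real y" for t
    by (simp add: linepath_def complex_eq_iff algebra_simps)
  have dir: "Complex b y - Complex a y = of_real b - of_real a"
    by (simp add: complex_eq_iff)
  have "contour_integral (linepath (Complex a y) (Complex b y)) f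
      = contour_integral (linepath (of_real a) (of_real b)) (\<lambda>w. f (w + \<i> * of_real y))"
    by (simp add: contour_integral_integral shift dir)
  also have "\<dots> = integral {a..b} (\<lambda>x. f (of_real x + \<i> * of_real y))"
    using assms by (subst contour_integral_linepath_Reals_eq) auto
  finally show ?thesis by (simp add: Complex_eq)
qed

lemma Cauchy_formula_rectangle:
  fixes F :: "complex \<Rightarrow> complex" and a b R :: real
  defines "K \<equiv> \<lambda>z x y. F (Complex x y) / (Complex x y - z)"
  assumes F: "F holomorphic_on Cplus" and a: "0 < a" "a < Im z" "Im z < b" and R: "\<bar>Re z\<bar> < R"
  shows "2 * pi * \<i> * F z = integral {-R..R} (\<lambda>x. K z x a) - integral {-R..R} (\<lambda>x. K z x b)
           + \<i> * integral {a..b} (K z R) - \<i> * integral {a..b} (K z (- R))"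
proof -
  define g where "g w = F w / (w - z)" for w
  define p where "p = rectpath (Complex (- R) a) (Complex R b)"
  have cvx: "convex Cplus" unfolding Cplus_def by (rule convex_halfspace_Im_gt)
  have op: "open Cplus" unfolding Cplus_def by (rule open_halfspace_Im_gt)
  have box: "z \<in> box (Complex (- R) a) (Complex R b)"
    using a R by (auto simp: in_box_complex_iff)
  have img: "path_image p \<subseteq> Cplus - {z}"
    unfolding p_def using a R box
    by (subst path_image_rectpath_cbox_minus_box) (auto simp: Cplus_def in_cbox_complex_iff)
  have zin: "z \<in> Cplus" using a by (auto simp: Cplus_def)
  have "((\<lambda>w. F w / (w - z)) has_contour_integral (2*pi * \<i> * winding_number p z * F z)) p"
    using op zin img by (intro Cauchy_integral_formula_convex_simple[OF cvx F])
      (auto simp: interior_open p_def)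
  moreover have "winding_number p z = 1"
    unfolding p_def by (rule winding_number_rectpath[OF box])
  ultimately have 1: "2 * pi * \<i> * F z = contour_integral p g"
    by (simp add: contour_integral_unique g_def[abs_def])
  have cont: "continuous_on (Cplus - {z}) g"
    unfolding g_def using holomorphic_on_imp_continuous_on[OF F]
    by (auto intro!: continuous_intros elim: continuous_on_subset)
  have seg: "g contour_integrable_on linepath u v" if "closed_segment u v \<subseteq> path_image p" for u v
    using cont that img by (intro contour_integrable_continuous_linepath) (meson continuous_on_subset order_trans)
  let ?a1 = "Complex (- R) a" and ?a2 = "Complex R a" and ?a3 = "Complex R b" and ?a4 = "Complex (- R) b"
  have pi: "path_image p = closed_segment ?a1 ?a2 \<union> closed_segment ?a2 ?a3 \<union> closed_segment ?a3 ?a4 \<union> closed_segment ?a4 ?a1"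
    unfolding p_def rectpath_def Let_def by (simp add: path_image_join Un_assoc)
  have pp: "p = linepath ?a1 ?a2 +++ linepath ?a2 ?a3 +++ linepath ?a3 ?a4 +++ linepath ?a4 ?a1"
    unfolding p_def rectpath_def Let_def by simp
  have s: "g contour_integrable_on linepath ?a1 ?a2" "g contour_integrable_on linepath ?a2 ?a3"
     "g contour_integrable_on linepath ?a3 ?a4" "g contour_integrable_on linepath ?a4 ?a1"
    by (rule seg; use pi in blast)+
  have "contour_integral p g = contour_integral (linepath ?a1 ?a2) g + (contour_integral (linepath ?a2 ?a3) g
     + (contour_integral (linepath ?a3 ?a4) g + contour_integral (linepath ?a4 ?a1) g))"
    unfolding pp using s by (simp add: contour_integrable_join valid_path_join contour_integral_join)
  also have "contour_integral (linepath ?a3 ?a4) g = - contour_integral (linepath ?a4 ?a3) g"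
    using contour_integral_reverse_linepath cont img pi
    by (metis (no_types, lifting) Un_upper1 Un_upper2 contour_integral_reverse_linepath continuous_on_subset le_sup_iff)
  also have "contour_integral (linepath ?a4 ?a1) g = - contour_integral (linepath ?a1 ?a4) g"
    using contour_integral_reverse_linepath cont img pi
    by (metis (no_types, lifting) Un_upper1 Un_upper2 contour_integral_reverse_linepath continuous_on_subset le_sup_iff)
  also have "contour_integral (linepath ?a1 ?a2) g = integral {-R..R} (\<lambda>x. g (Complex x a))"
    using R by (intro contour_integral_linepath_same_Im) auto
  also have "contour_integral (linepath ?a4 ?a3) g = integral {-R..R} (\<lambda>x. g (Complex x b))"
    using R by (intro contour_integral_linepath_same_Im) auto
  also have "contour_integral (linepath ?a2 ?a3) g = \<i> * integral {a..b} (\<lambda>y. g (Complex R y))"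
    using a by (intro contour_integral_linepath_same_Re) auto
  also have "contour_integral (linepath ?a1 ?a4) g = \<i> * integral {a..b} (\<lambda>y. g (Complex (-R) y))"
    using a by (intro contour_integral_linepath_same_Re) auto
  finally show ?thesis unfolding 1 K_def g_def by simp
qed

lemma nn_integral_Cauchy_kernel:
  fixes z :: complex
  assumes "y \<noteq> Im z"
  shows "(\<integral>\<^sup>+x. ennreal ((cmod (1 / (Complex x y - z)))\<^sup>2) \<partial>lborel) = ennreal (pi / \<bar>y - Im z\<bar>)"
proof -
  define d where "d = \<bar>y - Im z\<bar>"
  have d: "d > 0" using assms by (simp add: d_def)
  have i: "integrable lborel (\<lambda>x::real. inverse (1 + x\<^sup>2))"
    using integrable_inverse_1_plus_square by (simp add: set_integrable_def)
  have "(LINT x|lborel. inverse (1 + x\<^sup>2 :: real)) = pi"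
    using LBINT_inverse_1_plus_square by (simp add: interval_lebesgue_integral_def set_lebesgue_integral_def)
  then have "ennreal pi = (\<integral>\<^sup>+x. ennreal (inverse (1 + x\<^sup>2)) \<partial>lborel)"
    using i by (subst nn_integral_eq_integral) auto
  also have "\<dots> = ennreal \<bar>1 / d\<bar> * (\<integral>\<^sup>+x. ennreal (inverse (1 + (- Re z / d + 1 / d * x)\<^sup>2)) \<partial>lborel)"
    using d by (intro nn_integral_real_affine) auto
  also have "\<dots> = ennreal \<bar>1 / d\<bar> * (\<integral>\<^sup>+x. ennreal (d\<^sup>2) * ennreal ((cmod (1 / (Complex x y - z)))\<^sup>2) \<partial>lborel)"
  proof (intro arg_cong2[where f = "(*)"] nn_integral_cong refl)
    fix x
    have "(cmod (Complex x y - z))\<^sup>2 = (x - Re z)\<^sup>2 + d\<^sup>2"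
      unfolding cmod_power2 d_def by simp
    moreover have "(x - Re z)\<^sup>2 + d\<^sup>2 > 0" using d by (simp add: add_nonneg_pos)
    moreover have "1 + (- Re z / d + 1 / d * x)\<^sup>2 = ((x - Re z)\<^sup>2 + d\<^sup>2) / d\<^sup>2"
      using d by (simp add: field_simps power2_eq_square)
    ultimately have "inverse (1 + (- Re z / d + 1 / d * x)\<^sup>2) = d\<^sup>2 * (cmod (1 / (Complex x y - z)))\<^sup>2"
      by (simp add: norm_divide power_divide)
    then show "ennreal (inverse (1 + (- Re z / d + 1 / d * x)\<^sup>2)) = ennreal (d\<^sup>2) * ennreal ((cmod (1 / (Complex x y - z)))\<^sup>2)"
      by (simp flip: ennreal_mult)
  qed
  also have "\<dots> = ennreal \<bar>1 / d\<bar> * (ennreal (d\<^sup>2) * (\<integral>\<^sup>+x. ennreal ((cmod (1 / (Complex x y - z)))\<^sup>2) \<partial>lborel))"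
    by (subst nn_integral_cmult) (auto simp: Complex_eq)
  also have "\<dots> = ennreal d * (\<integral>\<^sup>+x. ennreal ((cmod (1 / (Complex x y - z)))\<^sup>2) \<partial>lborel)"
    using d by (simp add: power2_eq_square flip: mult.assoc ennreal_mult)
  finally have "ennreal (1 / d) * ennreal pi = ennreal (1 / d) * (ennreal d * (\<integral>\<^sup>+x. ennreal ((cmod (1 / (Complex x y - z)))\<^sup>2) \<partial>lborel))"
    by simp
  then show ?thesis
    using d unfolding d_def[symmetric] by (simp flip: mult.assoc ennreal_mult)
qed

lemma continuous_on_horizontal_line:
  assumes F: "F holomorphic_on Cplus" and y: "y > 0"
  shows "continuous_on S (\<lambda>x. F (Complex x y))"
  by (rule continuous_on_compose2[OF holomorphic_on_imp_continuous_on[OF F]])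
     (use y in \<open>auto simp: Cplus_def Complex_eq intro!: continuous_intros\<close>)

lemma horizontal_line_measurable:
  assumes F: "F holomorphic_on Cplus" and y: "y > 0"
  shows "(\<lambda>x. F (Complex x y)) \<in> borel_measurable borel"
  by (intro borel_measurable_continuous_onI continuous_on_horizontal_line assms)

lemma continuous_on_vertical_segment:
  assumes F: "F holomorphic_on Cplus" and a: "a > 0"
  shows "continuous_on {a..b} (\<lambda>v. F (Complex x v))"
  by (rule continuous_on_compose2[OF holomorphic_on_imp_continuous_on[OF F]])
     (use a in \<open>auto simp: Cplus_def Complex_eq intro!: continuous_intros\<close>)

lemma emeasure_lborel_atLeast: "emeasure lborel {c::real..} = \<infinity>"
proof -
  have "of_nat n \<le> emeasure lborel {c..}" for n
    using emeasure_mono[of "{c..c + real n}" "{c..}" lborel] by (auto simp: ennreal_of_nat_eq_real_of_nat)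
  then have "\<not> emeasure lborel {c..} < \<infinity>"
    using ennreal_Ex_less_of_nat[of "emeasure lborel {c..}"] by (auto simp: not_le[symmetric])
  then show ?thesis using less_top[of "emeasure lborel {c..}"] by fastforce
qed

text \<open>By Tonelli, \<open>|F|\<^sup>2\<close> is integrable over the strip between the heights \<open>a\<close> and \<open>b\<close>. Hence its
  integral over the vertical segment at \<open>x\<close> is an integrable function of \<open>x\<close> and cannot stay above
  a positive constant for all large \<open>|x|\<close>. No decay is asked for: the Cauchy kernel provides it.\<close>

lemma small_vertical_sides:
  fixes F :: "complex \<Rightarrow> complex" and a b M N :: real
  assumes F: "F holomorphic_on Cplus" and a: "0 < a" "a < b"
    and M: "\<And>y. y > 0 \<Longrightarrow> (\<integral>\<^sup>+x. ennreal ((cmod (F (Complex x y)))\<^sup>2) \<partial>lborel) \<le> ennreal M"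
  obtains R where "R \<ge> N" "integral {a..b} (\<lambda>v. (cmod (F (Complex R v)))\<^sup>2) < 1"
    "integral {a..b} (\<lambda>v. (cmod (F (Complex (- R) v)))\<^sup>2) < 1"
proof -
  \<comment> \<open>The extension of \<open>F\<close> by zero is Borel measurable on the whole plane, as Tonelli requires.\<close>
  define G where "G z = indicator Cplus z *\<^sub>R F z" for z
  have Cm: "Cplus \<in> sets borel"
    unfolding Cplus_def by (simp add: open_halfspace_Im_gt)
  have [measurable]: "G \<in> borel_measurable borel"
    unfolding G_def[abs_def]
    by (rule borel_measurable_continuous_on_indicator[OF Cm holomorphic_on_imp_continuous_on[OF F]])
  have GF: "G (Complex x v) = F (Complex x v)" if "v > 0" for x v
    using that by (simp add: G_def Cplus_def)
  define h where "h x = (\<integral>\<^sup>+v. ennreal ((cmod (G (Complex x v)))\<^sup>2) * indicator {a..b} v \<partial>lborel)" for x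
  have [measurable]: "(\<lambda>(x, v). Complex x v) \<in> borel_measurable (borel \<Otimes>\<^sub>M borel)"
    unfolding Complex_eq by measurable
  have m2: "(\<lambda>(x, v). ennreal ((cmod (G (Complex x v)))\<^sup>2) * indicator {a..b} v) \<in> borel_measurable (borel \<Otimes>\<^sub>M borel)"
    by measurable
  have m2': "(\<lambda>(x, v). ennreal ((cmod (G (Complex x v)))\<^sup>2) * indicator {a..b} v) \<in> borel_measurable (lborel \<Otimes>\<^sub>M lborel)"
    using m2 by (simp cong: measurable_cong_sets sets_pair_measure_cong)
  have [measurable]: "h \<in> borel_measurable borel"
    using lborel.borel_measurable_nn_integral[OF m2'] unfolding h_def[abs_def] by simp
  have "(\<integral>\<^sup>+x. h x \<partial>lborel) = (\<integral>\<^sup>+v. (\<integral>\<^sup>+x. ennreal ((cmod (G (Complex x v)))\<^sup>2) * indicator {a..b} v \<partial>lborel) \<partial>lborel)"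
    unfolding h_def by (rule lborel_pair.Fubini'[OF m2', symmetric])
  also have "\<dots> \<le> (\<integral>\<^sup>+v. ennreal M * indicator {a..b} v \<partial>lborel)"
  proof (rule nn_integral_mono)
    fix v
    show "(\<integral>\<^sup>+x. ennreal ((cmod (G (Complex x v)))\<^sup>2) * indicator {a..b} v \<partial>lborel) \<le> ennreal M * indicator {a..b} v"
      using a M[of v] by (auto simp: GF indicator_def)
  qed
  also have "\<dots> < \<infinity>"
    using a by (simp add: nn_integral_cmult ennreal_mult_less_top flip: ennreal_mult)
  finally have fin: "(\<integral>\<^sup>+x. h x \<partial>lborel) < \<infinity>" .
  have fin': "(\<integral>\<^sup>+x. h (- x) \<partial>lborel) < \<infinity>"
    using fin nn_integral_real_affine[of h "-1" 0] by simp
  \<comment> \<open>Otherwise an integrable function would be at least \<open>1\<close> on a half-line.\<close>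
  have "\<exists>R\<ge>N. h R + h (- R) < 1"
  proof (rule ccontr)
    assume *: "\<not> ?thesis"
    have "\<infinity> = (\<integral>\<^sup>+x. indicator {N..} x \<partial>(lborel :: real measure))"
      by (simp add: emeasure_lborel_atLeast)
    also have "\<dots> \<le> (\<integral>\<^sup>+x. h x + h (- x) \<partial>lborel)"
      using * by (intro nn_integral_mono) (auto simp: indicator_def not_less)
    also have "\<dots> = (\<integral>\<^sup>+x. h x \<partial>lborel) + (\<integral>\<^sup>+x. h (- x) \<partial>lborel)"
      by (rule nn_integral_add) auto
    also have "\<dots> < \<infinity>" using fin fin' by simp
    finally show False by simp
  qed
  then obtain R where R: "R \<ge> N" "h R + h (- R) < 1" by blast
  have hint: "h x = ennreal (integral {a..b} (\<lambda>v. (cmod (F (Complex x v)))\<^sup>2))" for x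
  proof -
    have si: "set_integrable lborel {a..b} (\<lambda>v. (cmod (F (Complex x v)))\<^sup>2)"
      by (intro borel_integrable_atLeastAtMost' continuous_intros continuous_on_vertical_segment F a)
    have "h x = (\<integral>\<^sup>+v. ennreal (indicator {a..b} v *\<^sub>R (cmod (F (Complex x v)))\<^sup>2) \<partial>lborel)"
      unfolding h_def using a by (intro nn_integral_cong) (auto simp: indicator_def GF)
    also have "\<dots> = ennreal (LINT v:{a..b}|lborel. (cmod (F (Complex x v)))\<^sup>2)"
      using si unfolding set_lebesgue_integral_def set_integrable_def
      by (intro nn_integral_eq_integral) auto
    finally show ?thesis using set_borel_integral_eq_integral(2)[OF si] by simp
  qed
  have "integral {a..b} (\<lambda>v. (cmod (F (Complex x v)))\<^sup>2) < 1" if "h x < 1" for x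
    using that unfolding hint by (simp add: ennreal_less_one_iff)
  moreover have "h R < 1" "h (- R) < 1"
    using R(2) by (auto intro: le_less_trans[rotated])
  ultimately show ?thesis using that R(1) by blast
qed

lemma vertical_side_bound:
  fixes F :: "complex \<Rightarrow> complex" and a b x :: real
  assumes F: "F holomorphic_on Cplus" and a: "0 < a" "a < b" and x: "x \<noteq> Re z"
    and h: "integral {a..b} (\<lambda>v. (cmod (F (Complex x v)))\<^sup>2) < 1"
  shows "cmod (integral {a..b} (\<lambda>v. F (Complex x v) / (Complex x v - z))) \<le> (b - a + 1) / \<bar>x - Re z\<bar>"
proof -
  have ne: "Complex x v - z \<noteq> 0" for v using x by (auto simp: complex_eq_iff)
  have cont: "continuous_on {a..b} (\<lambda>v. F (Complex x v) / (Complex x v - z))"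
    using ne by (intro continuous_intros continuous_on_vertical_segment F a) (auto simp: Complex_eq intro!: continuous_intros)
  have i: "(\<lambda>v. (cmod (F (Complex x v)))\<^sup>2) integrable_on {a..b}"
    by (intro integrable_continuous_real continuous_intros continuous_on_vertical_segment F a)
  have i2: "(\<lambda>v. (1 + (cmod (F (Complex x v)))\<^sup>2) / \<bar>x - Re z\<bar>) integrable_on {a..b}"
    using x by (intro integrable_continuous_real continuous_intros continuous_on_vertical_segment F a) auto
  have "cmod (integral {a..b} (\<lambda>v. F (Complex x v) / (Complex x v - z)))
      \<le> integral {a..b} (\<lambda>v. (1 + (cmod (F (Complex x v)))\<^sup>2) / \<bar>x - Re z\<bar>)"
  proof (rule integral_norm_bound_integral[OF integrable_continuous_real[OF cont] i2])
    fix v assume "v \<in> {a..b}"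
    have "\<bar>x - Re z\<bar> \<le> cmod (Complex x v - z)"
      using abs_Re_le_cmod[of "Complex x v - z"] by simp
    \<comment> \<open>The bound for \<open>|F|\<^sup>2\<close> is used through \<open>|F| \<le> 1 + |F|\<^sup>2\<close>, since the kernel already decays.\<close>
    moreover have "cmod (F (Complex x v)) \<le> 1 + (cmod (F (Complex x v)))\<^sup>2"
      using sum_squares_bound[of 1 "cmod (F (Complex x v))"] norm_ge_zero[of "F (Complex x v)"]
      unfolding power2_eq_square by linarith
    ultimately show "cmod (F (Complex x v) / (Complex x v - z)) \<le> (1 + (cmod (F (Complex x v)))\<^sup>2) / \<bar>x - Re z\<bar>"
      using x unfolding norm_divide by (intro frac_le) auto
  qed
  also have "\<dots> = (b - a + integral {a..b} (\<lambda>v. (cmod (F (Complex x v)))\<^sup>2)) / \<bar>x - Re z\<bar>"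
    using i a by (simp add: Henstock_Kurzweil_Integration.integral_add[OF integrable_const_ivl] divide_inverse)
  also have "\<dots> \<le> (b - a + 1) / \<bar>x - Re z\<bar>"
    using h by (intro divide_right_mono) auto
  finally show ?thesis .
qed

text \<open>Cauchy's formula on rectangles whose vertical sides escape to infinity along the positions of
  \<open>small_vertical_sides\<close> leaves the two horizontal lines at heights \<open>a\<close> and \<open>b\<close>. On the upper line
  the Cauchy kernel has squared \<open>L\<^sup>2\<close> norm \<open>\<pi> / (b - Im z)\<close>, so that contribution vanishes as
  \<open>b\<close> grows.\<close>

theorem Cauchy_formula_upper_half_plane:
  fixes F :: "complex \<Rightarrow> complex" and a M :: real
  assumes F: "F holomorphic_on Cplus" and M0: "M > 0"
    and M: "\<And>y. y > 0 \<Longrightarrow> (\<integral>\<^sup>+x. ennreal ((cmod (F (Complex x y)))\<^sup>2) \<partial>lborel) \<le> ennreal M"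
    and a: "0 < a" "a < Im z"
  shows "(LINT x|lborel. F (Complex x a) * (1 / (Complex x a - z))) = 2 * pi * \<i> * F z"
proof -
  define K where "K y x = F (Complex x y) * (1 / (Complex x y - z))" for y x
  have Kprod: "integrable lborel (K y)" "cmod (LINT x|lborel. K y x) \<le> sqrt (M * (pi / \<bar>y - Im z\<bar>))"
    if "y > 0" "y \<noteq> Im z" for y
  proof -
    have [measurable]: "(\<lambda>x. F (Complex x y)) \<in> borel_measurable borel"
      by (rule horizontal_line_measurable[OF F that(1)])
    have m: "(\<lambda>x. 1 / (Complex x y - z)) \<in> borel_measurable borel"
      unfolding Complex_eq by measurable
    show "integrable lborel (K y)" "cmod (LINT x|lborel. K y x) \<le> sqrt (M * (pi / \<bar>y - Im z\<bar>))"
      unfolding K_def[abs_def]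
      by (rule product_of_square_integrable[OF _ _ M[OF that(1)] M0 eq_refl[OF nn_integral_Cauchy_kernel[OF that(2)]]];
          use that m in \<open>simp\<close>)+
  qed
  have strip: "2 * pi * \<i> * F z = (LINT x|lborel. K a x) - (LINT x|lborel. K b x)" if b: "b > Im z" for b
  proof -
    have ab: "a < b" using a b by simp
    \<comment> \<open>The summand \<open>\<bar>Re z\<bar> + 1\<close> keeps the sides at distance more than \<open>n\<close> from \<open>z\<close>.\<close>
    have "\<forall>n. \<exists>R. R \<ge> real n + \<bar>Re z\<bar> + 1 \<and> integral {a..b} (\<lambda>v. (cmod (F (Complex R v)))\<^sup>2) < 1
       \<and> integral {a..b} (\<lambda>v. (cmod (F (Complex (- R) v)))\<^sup>2) < 1"
      using small_vertical_sides[OF F a(1) ab M] by metis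
    then obtain R where R: "\<And>n. R n \<ge> real n + \<bar>Re z\<bar> + 1"
      "\<And>n. integral {a..b} (\<lambda>v. (cmod (F (Complex (R n) v)))\<^sup>2) < 1"
      "\<And>n. integral {a..b} (\<lambda>v. (cmod (F (Complex (- R n) v)))\<^sup>2) < 1"
      by metis
    have horiz: "(\<lambda>n. integral {- R n..R n} (K y)) \<longlonglongrightarrow> (LINT x|lborel. K y x)" if y: "y > 0" "y \<noteq> Im z" for y
    proof -
      have [measurable]: "K y \<in> borel_measurable borel" using Kprod(1)[OF y] by auto
      have "(\<lambda>n. LINT x|lborel. indicator {- R n..R n} x *\<^sub>R K y x) \<longlonglongrightarrow> (LINT x|lborel. K y x)"
      proof (rule integral_dominated_convergence[where w = "\<lambda>x. cmod (K y x)"])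
        show "AE x in lborel. (\<lambda>n. indicator {- R n..R n} x *\<^sub>R K y x) \<longlonglongrightarrow> K y x"
        proof (rule AE_I2)
          fix x
          have "\<forall>\<^sub>F n in sequentially. real n \<ge> \<bar>x\<bar>"
            by (rule eventually_sequentiallyI[of "nat \<lceil>\<bar>x\<bar>\<rceil>"]) linarith
          then have "\<forall>\<^sub>F n in sequentially. indicator {- R n..R n} x *\<^sub>R K y x = K y x"
          proof eventually_elim
            case (elim n)
            have "x \<in> {- R n..R n}" using elim R(1)[of n] by auto
            then show ?case by simp
          qed
          then show "(\<lambda>n. indicator {- R n..R n} x *\<^sub>R K y x) \<longlonglongrightarrow> K y x"
            by (rule tendsto_eventually)
        qed
        show "AE x in lborel. norm (indicator {- R n..R n} x *\<^sub>R K y x) \<le> cmod (K y x)" for n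
          by (auto simp: indicator_def)
      qed (use Kprod(1)[OF y] in auto)
      moreover have "(LINT x|lborel. indicator {- R n..R n} x *\<^sub>R K y x) = integral {- R n..R n} (K y)" for n
      proof -
        have "set_integrable lborel {- R n..R n} (K y)"
          unfolding set_integrable_def by (rule integrable_mult_indicator) (use Kprod(1)[OF y] in auto)
        from set_borel_integral_eq_integral(2)[OF this] show ?thesis
          by (simp add: set_lebesgue_integral_def)
      qed
      ultimately show ?thesis by simp
    qed
    define V where "V x = integral {a..b} (\<lambda>v. F (Complex x v) / (Complex x v - z))" for x
    have sides: "(\<lambda>n. V (s * R n)) \<longlonglongrightarrow> 0" if s: "s = 1 \<or> s = - 1" for s
    proof (rule tendsto_0_le)
      show "(\<lambda>n. 1 / real (Suc n)) \<longlonglongrightarrow> 0"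
        using LIMSEQ_inverse_real_of_nat by (simp add: divide_inverse)
      show "\<forall>\<^sub>F n in sequentially. norm (V (s * R n)) \<le> norm (1 / real (Suc n)) * (b - a + 1)"
      proof (rule always_eventually, rule allI)
        fix n
        have d: "\<bar>s * R n - Re z\<bar> \<ge> real n + 1" using R(1)[of n] s by auto
        have "norm (V (s * R n)) \<le> (b - a + 1) / \<bar>s * R n - Re z\<bar>"
          unfolding V_def using d s R(2,3)[of n]
          by (intro vertical_side_bound F a ab) auto
        also have "\<dots> \<le> (b - a + 1) / (real n + 1)"
          using d ab by (intro divide_left_mono) auto
        finally show "norm (V (s * R n)) \<le> norm (1 / real (Suc n)) * (b - a + 1)"
          by (simp add: add.commute)
      qed
    qed
    have rect: "2 * pi * \<i> * F z = integral {- R n..R n} (K a) - integral {- R n..R n} (K b)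
        + \<i> * V (1 * R n) - \<i> * V (- 1 * R n)" for n
      using Cauchy_formula_rectangle[OF F a b, of "R n"] R(1)[of n]
      by (simp add: K_def[abs_def] V_def)
    have "(\<lambda>n. integral {- R n..R n} (K a) - integral {- R n..R n} (K b)
        + \<i> * V (1 * R n) - \<i> * V (- 1 * R n)) \<longlonglongrightarrow> (LINT x|lborel. K a x) - (LINT x|lborel. K b x) + \<i> * 0 - \<i> * 0"
      using a b by (intro tendsto_intros horiz sides) auto
    then show ?thesis
      unfolding rect[symmetric] by (simp add: LIMSEQ_const_iff)
  qed
  \<comment> \<open>The error \<open>D\<close> is the integral over the upper line at height \<open>Im z + d\<close>, for every \<open>d > 0\<close>.\<close>
  define D where "D = 2 * pi * \<i> * F z - (LINT x|lborel. K a x)"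
  have bound: "cmod D \<le> sqrt (M * (pi / d))" if d: "d > 0" for d
  proof -
    have "D = - (LINT x|lborel. K (Im z + d) x)"
      unfolding D_def using strip[of "Im z + d"] d by simp
    then show ?thesis using Kprod(2)[of "Im z + d"] d a by simp
  qed
  have "((\<lambda>d. sqrt (M * (pi / d))) \<longlongrightarrow> sqrt (M * 0)) at_top"
    by (intro tendsto_intros tendsto_divide_0[OF tendsto_const] filterlim_at_top_imp_at_infinity filterlim_ident)
  then have "cmod D \<le> sqrt (M * 0)"
    by (rule tendsto_lowerbound) (rule eventually_mono[OF eventually_gt_at_top[of 0] bound], simp_all)
  then show ?thesis unfolding D_def K_def by simp
qed

section \<open>The Paley-Wiener theorem at a positive height\<close>

lemma half_line_exp:
  fixes w :: complex
  assumes w: "Im w > 0"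
  shows "set_integrable lborel {0<..} (\<lambda>t. exp (\<i> * w * of_real t))" (is ?A)
    and "(LINT t:{0<..}|lborel. exp (\<i> * w * of_real t)) = \<i> / w" (is ?B)
    and "(\<integral>\<^sup>+t. ennreal ((cmod (indicator {0<..} t *\<^sub>R exp (\<i> * w * of_real t)))\<^sup>2) \<partial>lborel) = ennreal (1 / (2 * Im w))" (is ?C)
proof -
  have norm: "cmod (exp (\<i> * w * of_real t)) = exp (- (t * Im w))" for t
    by (simp add: mult.commute)
  show A: ?A
    by (rule set_integrable_bound[OF integrable_I0i_exp_mscale[OF w]])
       (auto simp: norm set_borel_measurable_def)
  have w0: "w \<noteq> 0" using w by auto
  have "(LBINT t=0..\<infinity>. exp (\<i> * w * of_real t)) = 0 - exp (\<i> * w * of_real 0) / (\<i> * w)"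
  proof (rule interval_integral_FTC_integrable[where F = "\<lambda>t. exp (\<i> * w * of_real t) / (\<i> * w)"])
    show "((\<lambda>t. exp (\<i> * w * of_real t) / (\<i> * w)) has_vector_derivative exp (\<i> * w * of_real t)) (at t)" for t
      using w0 by (auto intro!: derivative_eq_intros has_vector_derivative_real_field)
    show "isCont (\<lambda>t. exp (\<i> * w * complex_of_real t)) t" for t
      by (intro continuous_intros)
    show "set_integrable lborel (einterval 0 \<infinity>) (\<lambda>t. exp (\<i> * w * of_real t))"
      using A by (simp add: zero_ereal_def)
    have "((\<lambda>t. exp (\<i> * w * complex_of_real t) / (\<i> * w)) \<longlongrightarrow> exp (\<i> * w * complex_of_real 0) / (\<i> * w)) (at_right 0)"
      using w0 by (intro tendsto_intros) auto
    then show "(((\<lambda>t. exp (\<i> * w * complex_of_real t) / (\<i> * w)) \<circ> real_of_ereal) \<longlongrightarrow> exp (\<i> * w * of_real 0) / (\<i> * w)) (at_right 0)"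
      by (simp add: zero_ereal_def ereal_tendsto_simps)
    have "((\<lambda>t. exp (- (t * Im w))) \<longlongrightarrow> 0) at_top"
      using w by (auto intro!: exp_at_bot[THEN filterlim_compose] filterlim_at_top_mult_tendsto_pos filterlim_ident
             simp: filterlim_uminus_at_bot)
    then have "((\<lambda>t. exp (\<i> * w * of_real t) / (\<i> * w)) \<longlongrightarrow> 0) at_top"
      by (intro tendsto_divide_zero tendsto_norm_zero_cancel[of "\<lambda>t. exp (\<i> * w * of_real t)"]) (simp only: norm)
    then show "(((\<lambda>t. exp (\<i> * w * of_real t) / (\<i> * w)) \<circ> real_of_ereal) \<longlongrightarrow> 0) (at_left \<infinity>)"
      by (simp add: ereal_tendsto_simps)
  qed simp
  also have "\<dots> = \<i> / w" by (simp add: divide_inverse)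
  finally show ?B
    by (simp add: interval_lebesgue_integral_0_infty)
  have w2: "0 < Im w * 2" using w by simp
  have "(\<integral>\<^sup>+t. ennreal ((cmod (indicator {0<..} t *\<^sub>R exp (\<i> * w * of_real t)))\<^sup>2) \<partial>lborel)
     = (\<integral>\<^sup>+t. ennreal (indicator {0<..} t *\<^sub>R exp (- (t * (Im w * 2)))) \<partial>lborel)"
    by (intro nn_integral_cong) (auto simp: indicator_def norm simp flip: exp_double power2_eq_square intro!: arg_cong[where f = exp])
  also have "\<dots> = ennreal (LINT t:{0<..}|lborel. exp (- (t * (Im w * 2))))"
    using integrable_I0i_exp_mscale[OF w2] unfolding set_lebesgue_integral_def set_integrable_def
    by (intro nn_integral_eq_integral) auto
  also have "(LINT t:{0<..}|lborel. exp (- (t * (Im w * 2)))) = 1 / (2 * Im w)"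
    using LBINT_I0i_exp_mscale[OF w2] by (simp add: interval_lebesgue_integral_0_infty mult.commute)
  finally show ?C .
qed

text \<open>Fubini moves the integral over \<open>t > 0\<close> inside, where \<open>exp(\<i>(z - s)t)\<close> integrates to
  \<open>\<i> / (z - s)\<close>. So cutting an inverse transform off to a half-line amounts to taking a Cauchy
  integral.\<close>

lemma fourier_half_line_transform:
  assumes g: "integrable lborel g" and z: "Im z > 0"
  shows "fourier (\<lambda>t. indicator {0<..} t *\<^sub>R fourier g (of_real (- t))) z
       = (LINT s|lborel. g s * (\<i> / (z - of_real s)))"
proof -
  define b where "b t = indicator {0<..} t *\<^sub>R exp (\<i> * z * of_real t)" for t :: real
  have b: "integrable lborel b"
    using half_line_exp(1)[OF z] unfolding b_def[abs_def] set_integrable_def .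
  have "fourier (\<lambda>t. indicator {0<..} t *\<^sub>R fourier g (of_real (- t))) z
      = (LINT t|lborel. LINT s|lborel. g s * b t * exp (\<i> * of_real (- t) * of_real s))"
    unfolding fourier_def
  proof (rule Bochner_Integration.integral_cong[OF refl])
    fix t :: real
    have "indicator {0<..} t *\<^sub>R (LINT s|lborel. g s * exp (\<i> * of_real (- t) * of_real s)) * exp (\<i> * z * of_real t)
      = b t * (LINT s|lborel. g s * exp (\<i> * of_real (- t) * of_real s))"
      by (simp add: b_def mult.commute)
    also have "\<dots> = (LINT s|lborel. b t * (g s * exp (\<i> * of_real (- t) * of_real s)))"
      by (rule integral_mult_right_zero[symmetric])
    finally show "indicator {0<..} t *\<^sub>R (LINT s|lborel. g s * exp (\<i> * of_real (- t) * of_real s)) * exp (\<i> * z * of_real t)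
       = (LINT s|lborel. g s * b t * exp (\<i> * of_real (- t) * of_real s))"
      by (simp only: mult_ac)
  qed
  also have "\<dots> = (LINT s|lborel. LINT t|lborel. g s * b t * exp (\<i> * of_real (- t) * of_real s))"
    using g b by (intro fubini_bounded_kernel[symmetric]) auto
  also have "\<dots> = (LINT s|lborel. g s * (\<i> / (z - of_real s)))"
  proof (rule Bochner_Integration.integral_cong[OF refl])
    fix s :: real
    have "(LINT t|lborel. g s * b t * exp (\<i> * of_real (- t) * of_real s))
       = (LINT t|lborel. g s * (indicator {0<..} t *\<^sub>R exp (\<i> * (z - of_real s) * of_real t)))"
      unfolding b_def by (rule Bochner_Integration.integral_cong[OF refl]) (simp add: algebra_simps flip: exp_add)
    also have "\<dots> = g s * (LINT t:{0<..}|lborel. exp (\<i> * (z - of_real s) * of_real t))"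
      unfolding set_lebesgue_integral_def by (rule integral_mult_right_zero)
    also have "\<dots> = g s * (\<i> / (z - of_real s))"
      using z by (subst half_line_exp(2)) auto
    finally show "(LINT t|lborel. g s * b t * exp (\<i> * of_real (- t) * of_real s)) = g s * (\<i> / (z - of_real s))" .
  qed
  finally show ?thesis .
qed

lemma inverse_fourier_bessel:
  assumes g: "integrable lborel g"
  shows "(\<integral>\<^sup>+t. ennreal ((cmod (indicator {0<..} t *\<^sub>R (fourier g (of_real (- t)) / (2 * pi))))\<^sup>2) \<partial>lborel)
     \<le> ennreal (1 / (2 * pi)) * (\<integral>\<^sup>+s. ennreal ((cmod (g s))\<^sup>2) \<partial>lborel)"
proof -
  have [measurable]: "g \<in> borel_measurable borel" using g by auto
  have c: "ennreal (1 / (2 * pi)\<^sup>2 * (2 * pi)) = ennreal (1 / (2 * pi)\<^sup>2) * ennreal (2 * pi)"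
    by (rule ennreal_mult) auto
  have "(\<integral>\<^sup>+t. ennreal ((cmod (indicator {0<..} t *\<^sub>R (fourier g (of_real (- t)) / (2 * pi))))\<^sup>2) \<partial>lborel)
     \<le> (\<integral>\<^sup>+t. ennreal (1 / (2 * pi)\<^sup>2) * ennreal ((cmod (fourier g (of_real (- t))))\<^sup>2) \<partial>lborel)"
    by (intro nn_integral_mono)
       (auto simp: indicator_def norm_divide power_divide norm_mult simp flip: ennreal_mult)
  also have "\<dots> = ennreal (1 / (2 * pi)\<^sup>2) * (\<integral>\<^sup>+t. ennreal ((cmod (fourier g (of_real (- t))))\<^sup>2) \<partial>lborel)"
    by (rule nn_integral_cmult) measurable
  also have "(\<integral>\<^sup>+t. ennreal ((cmod (fourier g (of_real (- t))))\<^sup>2) \<partial>lborel)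
     = (\<integral>\<^sup>+t. ennreal ((cmod (fourier g (of_real t)))\<^sup>2) \<partial>lborel)"
    using nn_integral_real_affine[of "\<lambda>t. ennreal ((cmod (fourier g (of_real t)))\<^sup>2)" "-1" 0] by simp
  also have "ennreal (1 / (2 * pi)\<^sup>2) * \<dots> \<le> ennreal (1 / (2 * pi)\<^sup>2) * (ennreal (2 * pi) * (\<integral>\<^sup>+s. ennreal ((cmod (g s))\<^sup>2) \<partial>lborel))"
    by (intro mult_left_mono fourier_bessel g) auto
  also have "\<dots> = ennreal (1 / (2 * pi)\<^sup>2 * (2 * pi)) * (\<integral>\<^sup>+s. ennreal ((cmod (g s))\<^sup>2) \<partial>lborel)"
    by (simp only: c mult.assoc)
  also have "1 / (2 * pi)\<^sup>2 * (2 * pi) = 1 / (2 * pi)" by (simp add: power2_eq_square)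
  finally show ?thesis .
qed

text \<open>The line at height \<open>a\<close> lies inside the half-plane, where \<open>F\<close> is continuous; its truncations to
  bounded intervals are therefore integrable, while \<open>F\<close> itself need not be integrable over the
  whole line. Their inverse
  transforms, cut off to \<open>t > 0\<close>, converge in \<open>L\<^sup>2\<close>, and the transform of the limit is the limit
  of Cauchy integrals, hence \<open>F\<close>.\<close>

theorem Paley_Wiener_at_height:
  fixes F :: "complex \<Rightarrow> complex" and a M :: real
  assumes F: "F holomorphic_on Cplus" and M0: "M > 0"
    and M: "\<And>y. y > 0 \<Longrightarrow> (\<integral>\<^sup>+x. ennreal ((cmod (F (Complex x y)))\<^sup>2) \<partial>lborel) \<le> ennreal M"
    and a: "0 < a"
  obtains f where "f \<in> borel_measurable borel" "\<And>t. t \<le> 0 \<Longrightarrow> f t = 0"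
    "(\<integral>\<^sup>+t. ennreal ((cmod (f t))\<^sup>2) \<partial>lborel) \<le> ennreal (M / (2 * pi))"
    "\<And>z. Im z > 0 \<Longrightarrow> fourier f z = F (z + \<i> * a)"
proof -
  define Fa where "Fa x = F (Complex x a)" for x
  have [measurable]: "Fa \<in> borel_measurable borel"
    unfolding Fa_def by (rule horizontal_line_measurable[OF F a])
  have Fa2: "(\<integral>\<^sup>+x. ennreal ((cmod (Fa x))\<^sup>2) \<partial>lborel) \<le> ennreal M"
    unfolding Fa_def by (rule M[OF a])
  have "\<forall>k. \<exists>N::nat. (\<integral>\<^sup>+x. ennreal ((cmod (Fa x - indicator {- real N..real N} x *\<^sub>R Fa x))\<^sup>2) \<partial>lborel) \<le> ennreal ((1 / 4) ^ k)"
  proof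
    fix k :: nat
    show "\<exists>N::nat. (\<integral>\<^sup>+x. ennreal ((cmod (Fa x - indicator {- real N..real N} x *\<^sub>R Fa x))\<^sup>2) \<partial>lborel) \<le> ennreal ((1 / 4) ^ k)"
      by (rule small_tail[of Fa "(1 / 4) ^ k"]) (use le_less_trans[OF Fa2] in auto)
  qed
  then obtain N :: "nat \<Rightarrow> nat" where
    N: "\<And>k. (\<integral>\<^sup>+x. ennreal ((cmod (Fa x - indicator {- real (N k)..real (N k)} x *\<^sub>R Fa x))\<^sup>2) \<partial>lborel) \<le> ennreal ((1 / 4) ^ k)"
    by metis
  \<comment> \<open>The truncation \<open>g k\<close> approximates \<open>Fa\<close> at the geometric rate that \<open>L2_complete\<close> asks for.\<close>
  define g where "g k x = indicator {- real (N k)..real (N k)} x *\<^sub>R Fa x" for k x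
  have gF: "(\<integral>\<^sup>+x. ennreal ((cmod (Fa x - g k x))\<^sup>2) \<partial>lborel) \<le> ennreal ((1 / 4) ^ k)" for k
    unfolding g_def by (rule N)
  have g: "integrable lborel (g k)" for k
    unfolding g_def[abs_def] set_integrable_def[symmetric] Fa_def
    by (intro borel_integrable_atLeastAtMost' continuous_on_horizontal_line F a)
  have [measurable]: "g k \<in> borel_measurable borel" for k using g[of k] by auto
  have gle: "(\<integral>\<^sup>+x. ennreal ((cmod (g k x))\<^sup>2) \<partial>lborel) \<le> ennreal M" for k
    by (rule order_trans[OF nn_integral_mono Fa2]) (auto simp: g_def indicator_def)
  have gg: "(\<integral>\<^sup>+x. ennreal ((cmod (g m x - g k x))\<^sup>2) \<partial>lborel) \<le> ennreal (4 * (1 / 4) ^ k)" if "k \<le> m" for k m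
  proof -
    have "(\<integral>\<^sup>+x. ennreal ((cmod (g m x - g k x))\<^sup>2) \<partial>lborel) \<le> 2 * (ennreal ((1 / 4) ^ m) + ennreal ((1 / 4) ^ k))"
      by (rule order_trans[OF nn_integral_square_diff_le[where h = Fa]])
         (auto intro!: mult_left_mono add_mono gF)
    also have "\<dots> \<le> 2 * (ennreal ((1 / 4) ^ k) + ennreal ((1 / 4) ^ k))"
      using that by (intro mult_left_mono add_mono ennreal_leI power_decreasing) auto
    also have "\<dots> = ennreal (4 * (1 / 4) ^ k)"
      by (simp add: ennreal_mult flip: distrib_right)
    finally show ?thesis .
  qed
  define f where "f k t = indicator {0<..} t *\<^sub>R (fourier (g k) (of_real (- t)) / (2 * pi))" for k t
  have [measurable]: "(\<lambda>t::real. fourier (g k) (of_real (- t))) \<in> borel_measurable borel" for k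
    by (rule measurable_compose[OF _ fourier_measurable]) auto
  have [measurable]: "f k \<in> borel_measurable borel" for k
    unfolding f_def[abs_def] by measurable
  have fdiff: "f m t - f k t = indicator {0<..} t *\<^sub>R (fourier (\<lambda>s. g m s - g k s) (of_real (- t)) / (2 * pi))" for m k t
  proof -
    have "integrable lborel (\<lambda>s. g k s * exp (\<i> * of_real (- t) * of_real s))" for k
      by (rule Bochner_Integration.integrable_bound[OF g[of k]]) (auto simp: norm_mult)
    then have "fourier (\<lambda>s. g m s - g k s) (of_real (- t)) = fourier (g m) (of_real (- t)) - fourier (g k) (of_real (- t))"
      unfolding fourier_def left_diff_distrib by (intro Bochner_Integration.integral_diff)
    then show ?thesis by (simp add: f_def diff_divide_distrib scaleR_diff_right)
  qed
  have ff: "(\<integral>\<^sup>+t. ennreal ((cmod (f m t - f k t))\<^sup>2) \<partial>lborel) \<le> ennreal (4 / (2 * pi) * (1 / 4) ^ k)" if "k \<le> m" for k m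
  proof -
    have "(\<integral>\<^sup>+t. ennreal ((cmod (f m t - f k t))\<^sup>2) \<partial>lborel) \<le> ennreal (1 / (2 * pi)) * (\<integral>\<^sup>+x. ennreal ((cmod (g m x - g k x))\<^sup>2) \<partial>lborel)"
      unfolding fdiff by (rule inverse_fourier_bessel) (intro Bochner_Integration.integrable_diff g)
    also have "\<dots> \<le> ennreal (1 / (2 * pi)) * ennreal (4 * (1 / 4) ^ k)"
      by (intro mult_left_mono gg that) auto
    finally show ?thesis by (simp flip: ennreal_mult)
  qed
  obtain f' where f'm: "f' \<in> borel_measurable lborel" and lim: "AE t in lborel. (\<lambda>k. f k t) \<longlonglongrightarrow> f' t"
    and f'f: "\<And>k. (\<integral>\<^sup>+t. ennreal ((cmod (f' t - f k t))\<^sup>2) \<partial>lborel) \<le> ennreal (4 / (2 * pi) * (1 / 4) ^ k)"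
    by (rule L2_complete[of f lborel "4 / (2 * pi)"]) (use ff in auto)
  \<comment> \<open>The limit is only determined almost everywhere; \<open>h\<close> vanishes on \<open>(-\<infinity>, 0]\<close> at every point.\<close>
  define h where "h t = indicator {0<..} t *\<^sub>R f' t" for t
  have [measurable]: "h \<in> borel_measurable borel" using f'm unfolding h_def by simp
  have h0: "h t = 0" if "t \<le> 0" for t using that by (simp add: h_def)
  have f0: "f k t = 0" if "t \<le> 0" for k t using that by (simp add: f_def)
  have hf: "(\<integral>\<^sup>+t. ennreal ((cmod (h t - f k t))\<^sup>2) \<partial>lborel) \<le> ennreal (4 / (2 * pi) * (1 / 4) ^ k)" for k
    by (rule order_trans[OF nn_integral_mono f'f]) (auto simp: h_def indicator_def f_def)
  have fle: "(\<integral>\<^sup>+t. ennreal ((cmod (f k t))\<^sup>2) \<partial>lborel) \<le> ennreal (M / (2 * pi))" for k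
  proof -
    have "(\<integral>\<^sup>+t. ennreal ((cmod (f k t))\<^sup>2) \<partial>lborel) \<le> ennreal (1 / (2 * pi)) * (\<integral>\<^sup>+x. ennreal ((cmod (g k x))\<^sup>2) \<partial>lborel)"
      unfolding f_def by (rule inverse_fourier_bessel[OF g])
    also have "\<dots> \<le> ennreal (1 / (2 * pi)) * ennreal M"
      by (intro mult_left_mono gle) auto
    finally show ?thesis using M0 by (simp flip: ennreal_mult)
  qed
  have hle: "(\<integral>\<^sup>+t. ennreal ((cmod (h t))\<^sup>2) \<partial>lborel) \<le> ennreal (M / (2 * pi))"
  proof -
    have "(\<integral>\<^sup>+t. ennreal ((cmod (h t))\<^sup>2) \<partial>lborel) \<le> (\<integral>\<^sup>+t. liminf (\<lambda>k. ennreal ((cmod (f k t))\<^sup>2)) \<partial>lborel)"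
    proof (rule nn_integral_mono_AE, use lim in eventually_elim)
      case (elim t)
      then have "(\<lambda>k. ennreal ((cmod (f k t))\<^sup>2)) \<longlonglongrightarrow> ennreal ((cmod (f' t))\<^sup>2)"
        by (intro tendsto_ennrealI tendsto_intros)
      then have "liminf (\<lambda>k. ennreal ((cmod (f k t))\<^sup>2)) = ennreal ((cmod (f' t))\<^sup>2)"
        by (intro lim_imp_Liminf) auto
      then show ?case by (simp add: h_def indicator_def)
    qed
    also have "\<dots> \<le> liminf (\<lambda>k. \<integral>\<^sup>+t. ennreal ((cmod (f k t))\<^sup>2) \<partial>lborel)"
      by (rule nn_integral_liminf) measurable
    also have "\<dots> \<le> ennreal (M / (2 * pi))"
      by (rule Liminf_le, simp) (intro always_eventually allI fle)
    finally show ?thesis .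
  qed
  have transform: "fourier h z = F (z + \<i> * a)" if z: "Im z > 0" for z
  proof -
    define e where "e t = indicator {0<..} t *\<^sub>R exp (\<i> * z * of_real t)" for t :: real
    have [measurable]: "e \<in> borel_measurable borel" unfolding e_def[abs_def] by measurable
    have e2: "(\<integral>\<^sup>+t. ennreal ((cmod (e t))\<^sup>2) \<partial>lborel) \<le> ennreal (1 / (2 * Im z))"
      unfolding e_def using half_line_exp(3)[OF z] by simp
    have fourier_e: "fourier p z = (LINT t|lborel. p t * e t)" if "\<And>t. t \<le> 0 \<Longrightarrow> p t = 0" for p
      unfolding fourier_def by (rule Bochner_Integration.integral_cong) (use that in \<open>auto simp: e_def indicator_def not_less\<close>)
    have Mp: "M / (2 * pi) > 0" "1 / (2 * Im z) > 0" using M0 z by auto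
    have "(\<lambda>k. LINT t|lborel. f k t * e t) \<longlonglongrightarrow> (LINT t|lborel. h t * e t)"
    proof (rule L2_pairing_tendsto[where C = "4 / (2 * pi)", OF _ _ _ _ _ _ hf Mp(2) e2])
      show "integrable lborel (\<lambda>t. f k t * e t)" for k
        by (rule product_of_square_integrable(1)[OF _ _ fle Mp(1) e2 Mp(2)]) auto
      show "integrable lborel (\<lambda>t. h t * e t)"
        by (rule product_of_square_integrable(1)[OF _ _ hle Mp(1) e2 Mp(2)]) auto
    qed auto
    then have left: "(\<lambda>k. fourier (f k) z) \<longlonglongrightarrow> fourier h z"
      using fourier_e[of h, OF h0] fourier_e[of "f _", OF f0] by simp
    \<comment> \<open>Up to a factor, \<open>c\<close> is the Cauchy kernel of the point \<open>z\<close> raised by \<open>a\<close>.\<close>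
    define c where "c s = \<i> / (z - of_real s)" for s :: real
    have [measurable]: "c \<in> borel_measurable borel" unfolding c_def[abs_def] by measurable
    define z' where "z' = z + \<i> * a"
    have z': "Im z' = Im z + a" "a \<noteq> Im z'" using z by (auto simp: z'_def)
    have cK: "c s = - \<i> * (1 / (Complex s a - z'))" for s
    proof -
      define w where "w = z - of_real s"
      have "Complex s a - z' = - w" by (simp add: w_def z'_def complex_eq_iff)
      then show ?thesis by (simp add: c_def flip: w_def)
    qed
    have c2: "(\<integral>\<^sup>+s. ennreal ((cmod (c s))\<^sup>2) \<partial>lborel) \<le> ennreal (pi / Im z)"
      using nn_integral_Cauchy_kernel[OF z'(2)] z z'(1) unfolding cK norm_mult by simp
    have cp: "pi / Im z > 0" using z by simp
    have right: "(\<lambda>k. LINT s|lborel. g k s * c s) \<longlonglongrightarrow> (LINT s|lborel. Fa s * c s)"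
    proof (rule L2_pairing_tendsto[where C = 1, OF _ _ _ _ _ _ _ cp c2])
      show "integrable lborel (\<lambda>s. g k s * c s)" for k
        by (rule product_of_square_integrable(1)[OF _ _ gle M0 c2 cp]) auto
      show "integrable lborel (\<lambda>s. Fa s * c s)"
        by (rule product_of_square_integrable(1)[OF _ _ Fa2 M0 c2 cp]) auto
    qed (use gF in auto)
    have "fourier (f k) z = (LINT s|lborel. g k s * c s) / (2 * pi)" for k
    proof -
      have "fourier (f k) z = (LINT t|lborel. (indicator {0<..} t *\<^sub>R fourier (g k) (of_real (- t))) * exp (\<i> * z * of_real t) / (2 * pi))"
        unfolding fourier_def[of "f k"] by (rule Bochner_Integration.integral_cong[OF refl]) (simp add: f_def scaleR_conv_of_real)
      also have "\<dots> = fourier (\<lambda>t. indicator {0<..} t *\<^sub>R fourier (g k) (of_real (- t))) z / (2 * pi)"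
        unfolding fourier_def[of _ z] by (rule integral_divide_zero)
      finally show ?thesis using fourier_half_line_transform[OF g z, of k] by (simp add: c_def)
    qed
    then have "(\<lambda>k. fourier (f k) z) \<longlonglongrightarrow> (LINT s|lborel. Fa s * c s) / (2 * pi)"
      by (simp only:) (intro tendsto_intros right, simp)
    then have "fourier h z = (LINT s|lborel. Fa s * c s) / (2 * pi)"
      by (rule LIMSEQ_unique[OF left])
    also have "(LINT s|lborel. Fa s * c s) = - \<i> * (LINT s|lborel. F (Complex s a) * (1 / (Complex s a - z')))"
      unfolding cK Fa_def by (simp add: mult_ac flip: integral_mult_right_zero)
    also have "\<dots> = - \<i> * (2 * pi * \<i> * F z')"
      using z a by (subst Cauchy_formula_upper_half_plane[OF F M0 M a]) (auto simp: z'_def)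
    finally show ?thesis by (simp add: z'_def)
  qed
  show ?thesis
    by (rule that[of h]) (use h0 hle transform in auto)
qed

section \<open>Functions with a holomorphic Fourier transform\<close>

text \<open>A class that contains all square-integrable functions on the half-line and, unlike those, is
  closed under multiplication by \<open>t\<close>. So derivatives of a transform can be expressed before it is
  known that they belong to the Hardy space.\<close>

definition transformable :: "(real \<Rightarrow> complex) \<Rightarrow> bool" where
  "transformable f \<longleftrightarrow> (\<forall>t\<le>0. f t = 0) \<and> (\<forall>z. Im z > 0 \<longrightarrow> integrable lborel (\<lambda>t. f t * exp (\<i> * z * of_real t)))"

lemma transformable_zero: "transformable f \<Longrightarrow> t \<le> 0 \<Longrightarrow> f t = 0"
  by (simp add: transformable_def)

lemma transformable_integrable:
  "transformable f \<Longrightarrow> Im z > 0 \<Longrightarrow> integrable lborel (\<lambda>t. f t * exp (\<i> * z * of_real t))"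
  by (simp add: transformable_def)

text \<open>The exponential factor can be divided out again.\<close>

lemma transformable_measurable:
  assumes "transformable f"
  shows "f \<in> borel_measurable borel"
proof -
  have [measurable]: "(\<lambda>t. f t * exp (\<i> * \<i> * of_real t)) \<in> borel_measurable borel"
    using transformable_integrable[OF assms, of \<i>] by auto
  have "(\<lambda>t. (f t * exp (\<i> * \<i> * of_real t)) * exp (- (\<i> * \<i> * of_real t))) \<in> borel_measurable borel"
    by measurable
  then show ?thesis by (simp add: mult.assoc flip: exp_add)
qed

lemma transformable_of_square_integrable:
  assumes [measurable]: "f \<in> borel_measurable borel" and f0: "\<And>t. t \<le> 0 \<Longrightarrow> f t = 0"
    and A: "(\<integral>\<^sup>+t. ennreal ((cmod (f t))\<^sup>2) \<partial>lborel) < \<infinity>"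
  shows "transformable f"
  unfolding transformable_def
proof (intro conjI allI impI f0)
  fix z assume z: "Im z > 0"
  obtain B where B: "(\<integral>\<^sup>+t. ennreal ((cmod (f t))\<^sup>2) \<partial>lborel) \<le> ennreal B" "B > 0"
  proof
    let ?I = "\<integral>\<^sup>+t. ennreal ((cmod (f t))\<^sup>2) \<partial>lborel"
    have "?I = ennreal (enn2real ?I)" using A by simp
    also have "\<dots> \<le> ennreal (enn2real ?I + 1)" by (intro ennreal_leI) simp
    finally show "?I \<le> ennreal (enn2real ?I + 1)" .
    show "enn2real ?I + 1 > 0" by (simp add: add_nonneg_pos)
  qed
  have "integrable lborel (\<lambda>t. f t * (indicator {0<..} t *\<^sub>R exp (\<i> * z * of_real t)))"
    using z by (intro product_of_square_integrable(1)[OF _ _ B(1) B(2) eq_refl[OF half_line_exp(3)[OF z]]]) auto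
  also have "(\<lambda>t. f t * (indicator {0<..} t *\<^sub>R exp (\<i> * z * of_real t))) = (\<lambda>t. f t * exp (\<i> * z * of_real t))"
    using f0 by (auto simp: indicator_def fun_eq_iff not_less)
  finally show "integrable lborel (\<lambda>t. f t * exp (\<i> * z * of_real t))" .
qed

lemma fourier_damped:
  "fourier (\<lambda>t. f t * exp (\<i> * w * of_real t)) z = fourier f (z + w)"
  unfolding fourier_def by (rule Bochner_Integration.integral_cong[OF refl]) (simp add: algebra_simps flip: exp_add)

text \<open>Half of the exponential decay absorbs the factor \<open>t\<close>.\<close>

lemma transformable_mult_ident:
  assumes f: "transformable f"
  shows "transformable (\<lambda>t. \<i> * of_real t * f t)"
  unfolding transformable_def
proof (intro conjI allI impI)
  fix z assume z: "Im z > 0"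
  have [measurable]: "f \<in> borel_measurable borel" by (rule transformable_measurable[OF f])
  define w where "w = \<i> * of_real (Im z / 2)"
  have w: "Im w > 0" using z by (simp add: w_def)
  show "integrable lborel (\<lambda>t. \<i> * of_real t * f t * exp (\<i> * z * of_real t))"
  proof (rule Bochner_Integration.integrable_bound)
    show "integrable lborel (\<lambda>t. of_real (2 / Im z) * (f t * exp (\<i> * w * of_real t)))"
      by (intro integrable_mult_right transformable_integrable f w)
    show "AE t in lborel. norm (\<i> * of_real t * f t * exp (\<i> * z * of_real t)) \<le> norm (of_real (2 / Im z) * (f t * exp (\<i> * w * of_real t)))"
    proof (rule AE_I2)
      fix t :: real
      show "norm (\<i> * of_real t * f t * exp (\<i> * z * of_real t)) \<le> norm (of_real (2 / Im z) * (f t * exp (\<i> * w * of_real t)))"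
      proof (cases "t \<le> 0")
        case True
        then show ?thesis by (simp add: transformable_zero[OF f])
      next
        case False
        have "Im z * t / 2 \<le> exp (Im z * t / 2)"
          using exp_ge_add_one_self[of "Im z * t / 2"] by linarith
        then have "t \<le> 2 / Im z * exp (Im z * t / 2)"
          using z by (simp add: field_simps)
        then have "t * exp (- (Im z * t)) \<le> 2 / Im z * exp (Im z * t / 2) * exp (- (Im z * t))"
          by (intro mult_right_mono) auto
        also have "\<dots> = 2 / Im z * exp (- (Im z * t / 2))"
          by (simp flip: exp_add)
        finally have "cmod (f t) * (t * exp (- (Im z * t))) \<le> cmod (f t) * (2 / Im z * exp (- (Im z * t / 2)))"
          by (intro mult_left_mono) auto
        then show ?thesis
          using False z by (simp add: norm_mult norm_divide w_def mult_ac)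
      qed
    qed
  qed measurable
qed (simp add: transformable_zero[OF f])

text \<open>Expanding \<open>exp(\<i>ht)\<close> to first order leaves a remainder of at most \<open>|h|\<^sup>2 t\<^sup>2 exp(|h|t)\<close>. For
  \<open>|h| < Im z / 2\<close> it is dominated by \<open>|h|\<^sup>2\<close> times an integrable function that does not
  depend on \<open>h\<close>.\<close>

lemma fourier_has_field_derivative:
  assumes f: "transformable f" and z: "Im z > 0"
  shows "(fourier f has_field_derivative fourier (\<lambda>t. \<i> * of_real t * f t) z) (at z)"
proof -
  define f1 where "f1 t = \<i> * of_real t * f t" for t
  define f2 where "f2 t = \<i> * of_real t * f1 t" for t
  have f1: "transformable f1" unfolding f1_def[abs_def] by (rule transformable_mult_ident[OF f])
  have f2: "transformable f2" unfolding f2_def[abs_def] by (rule transformable_mult_ident[OF f1])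
  define w where "w = \<i> * of_real (Im z / 2)"
  have w: "Im w > 0" using z by (simp add: w_def)
  define K where "K = (LINT t|lborel. cmod (f2 t * exp (\<i> * w * of_real t)))"
  have bound: "cmod ((fourier f (z + h) - fourier f z) / h - fourier f1 z) \<le> cmod h * K"
    if h: "h \<noteq> 0" "cmod h < Im z / 2" for h
  proof -
    have zh: "Im (z + h) > 0" using h abs_Im_le_cmod[of h] z by auto
    have eq: "fourier f (z + h) - fourier f z - h * fourier f1 z
        = (LINT t|lborel. f t * exp (\<i> * (z + h) * of_real t) - f t * exp (\<i> * z * of_real t) - h * (f1 t * exp (\<i> * z * of_real t)))"
      unfolding fourier_def
      using transformable_integrable[OF f zh] transformable_integrable[OF f z] transformable_integrable[OF f1 z]
      by simp
    have "cmod (fourier f (z + h) - fourier f z - h * fourier f1 z) \<le> (LINT t|lborel. (cmod h)\<^sup>2 * cmod (f2 t * exp (\<i> * w * of_real t)))"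
      unfolding eq
    proof (rule order_trans[OF integral_norm_bound integral_mono])
      show "integrable lborel (\<lambda>t. cmod (f t * exp (\<i> * (z + h) * of_real t) - f t * exp (\<i> * z * of_real t) - h * (f1 t * exp (\<i> * z * of_real t))))"
        using transformable_integrable[OF f zh] transformable_integrable[OF f z] transformable_integrable[OF f1 z]
        by simp
      show "integrable lborel (\<lambda>t. (cmod h)\<^sup>2 * cmod (f2 t * exp (\<i> * w * of_real t)))"
        using transformable_integrable[OF f2 w] by (intro integrable_mult_right integrable_norm)
      fix t :: real
      show "cmod (f t * exp (\<i> * (z + h) * of_real t) - f t * exp (\<i> * z * of_real t) - h * (f1 t * exp (\<i> * z * of_real t)))
          \<le> (cmod h)\<^sup>2 * cmod (f2 t * exp (\<i> * w * of_real t))"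
      proof (cases "t \<le> 0")
        case True
        then show ?thesis using transformable_zero[OF f] transformable_zero[OF f1] by simp
      next
        case False
        define u where "u = \<i> * h * of_real t"
        have "f t * exp (\<i> * (z + h) * of_real t) - f t * exp (\<i> * z * of_real t) - h * (f1 t * exp (\<i> * z * of_real t))
           = f t * exp (\<i> * z * of_real t) * (exp u - (1 + u))"
          by (simp add: f1_def u_def algebra_simps exp_add)
        also have "cmod \<dots> \<le> cmod (f t * exp (\<i> * z * of_real t)) * (exp \<bar>Re u\<bar> * (cmod u)\<^sup>2)"
          using Taylor_exp[of u 1] unfolding norm_mult
          by (intro mult_left_mono) (auto simp: power2_eq_square)
        also have "\<dots> \<le> cmod (f t * exp (\<i> * z * of_real t)) * (exp (Im z / 2 * t) * (cmod u)\<^sup>2)"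
        proof (intro mult_left_mono mult_right_mono)
          have "\<bar>Re u\<bar> \<le> cmod u" by (rule abs_Re_le_cmod)
          also have "\<dots> = cmod h * t" using False by (simp add: u_def norm_mult)
          also have "\<dots> \<le> Im z / 2 * t" using h False by (intro mult_right_mono) auto
          finally show "exp \<bar>Re u\<bar> \<le> exp (Im z / 2 * t)" by simp
        qed auto
        also have "\<dots> = (cmod h)\<^sup>2 * (t\<^sup>2 * cmod (f t) * (exp (- (Im z * t)) * exp (Im z / 2 * t)))"
          using False by (simp add: u_def norm_mult power_mult_distrib mult_ac)
        also have "exp (- (Im z * t)) * exp (Im z / 2 * t) = exp (- (Im z / 2 * t))"
          by (simp flip: exp_add)
        also have "(cmod h)\<^sup>2 * (t\<^sup>2 * cmod (f t) * \<dots>) = (cmod h)\<^sup>2 * cmod (f2 t * exp (\<i> * w * of_real t))"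
          using False by (simp add: f2_def f1_def w_def norm_mult power2_eq_square mult_ac)
        finally show ?thesis .
      qed
    qed
    also have "\<dots> = (cmod h)\<^sup>2 * K" unfolding K_def by (rule integral_mult_right_zero)
    finally have "cmod (fourier f (z + h) - fourier f z - h * fourier f1 z) / cmod h \<le> (cmod h)\<^sup>2 * K / cmod h"
      by (intro divide_right_mono) auto
    moreover have "(fourier f (z + h) - fourier f z) / h - fourier f1 z = (fourier f (z + h) - fourier f z - h * fourier f1 z) / h"
      using h by (simp add: diff_divide_distrib)
    ultimately show ?thesis
      using h by (simp add: norm_divide power2_eq_square)
  qed
  have "((\<lambda>h. (fourier f (z + h) - fourier f z) / h - fourier f1 z) \<longlongrightarrow> 0) (at 0)"
  proof (rule Lim_null_comparison)
    have "\<forall>\<^sub>F h in at 0. h \<noteq> 0 \<and> cmod h < Im z / 2"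
      using z by (auto simp: eventually_at intro!: exI[of _ "Im z / 2"])
    then show "\<forall>\<^sub>F h in at 0. norm ((fourier f (z + h) - fourier f z) / h - fourier f1 z) \<le> cmod h * K"
      by (rule eventually_mono) (use bound in blast)
    show "((\<lambda>h. cmod h * K) \<longlongrightarrow> 0) (at 0)"
      by (rule tendsto_eq_intros refl | simp)+
  qed
  then have "((\<lambda>h. (fourier f (z + h) - fourier f z) / h) \<longlongrightarrow> fourier f1 z) (at 0)"
    by (rule Lim_null[THEN iffD2])
  then show ?thesis unfolding DERIV_def f1_def .
qed

lemma open_Cplus: "open Cplus"
  unfolding Cplus_def by (rule open_halfspace_Im_gt)

lemma fourier_holomorphic:
  assumes f: "transformable f" and G: "\<And>z. z \<in> Cplus \<Longrightarrow> G z = fourier f z"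
  shows "G holomorphic_on Cplus"
proof -
  have "fourier f holomorphic_on Cplus"
    by (rule holomorphic_onI)
       (use fourier_has_field_derivative[OF f] in \<open>auto simp: Cplus_def field_differentiable_def intro: has_field_derivative_at_within\<close>)
  then show ?thesis using G by (simp cong: holomorphic_cong)
qed

lemma transformable_mult_power:
  "transformable f \<Longrightarrow> transformable (\<lambda>t. (\<i> * of_real t) ^ k * f t)"
proof (induction k)
  case (Suc k)
  then show ?case using transformable_mult_ident[of "\<lambda>t. (\<i> * of_real t) ^ k * f t"] by (simp add: mult.assoc)
qed simp

lemma higher_deriv_fourier:
  assumes f: "transformable f" and G: "\<And>z. z \<in> Cplus \<Longrightarrow> G z = fourier f z"
  shows "z \<in> Cplus \<Longrightarrow> (deriv ^^ k) G z = fourier (\<lambda>t. (\<i> * of_real t) ^ k * f t) z"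
proof (induction k arbitrary: z)
  case (Suc k)
  define fk where "fk t = (\<i> * of_real t) ^ k * f t" for t
  have "transformable fk" unfolding fk_def[abs_def] by (rule transformable_mult_power[OF f])
  then have "(fourier fk has_field_derivative fourier (\<lambda>t. \<i> * of_real t * fk t) z) (at z)"
    using Suc.prems by (intro fourier_has_field_derivative) (auto simp: Cplus_def)
  then have "((deriv ^^ k) G has_field_derivative fourier (\<lambda>t. \<i> * of_real t * fk t) z) (at z)"
    by (rule has_field_derivative_transform_within_open[OF _ open_Cplus Suc.prems])
       (simp add: Suc.IH fk_def[abs_def])
  then show ?case by (simp add: DERIV_imp_deriv fk_def[abs_def] mult.assoc)
qed (simp add: G)

lemma fourier_line_bound:
  assumes f: "transformable f" and y: "y > 0"
  shows "(\<integral>\<^sup>+x. ennreal ((cmod (fourier f (Complex x y)))\<^sup>2) \<partial>lborel)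
     \<le> ennreal (2 * pi) * (\<integral>\<^sup>+t. ennreal ((cmod (f t))\<^sup>2) \<partial>lborel)"
proof -
  define w where "w = \<i> * of_real y"
  have "(\<integral>\<^sup>+x. ennreal ((cmod (fourier f (Complex x y)))\<^sup>2) \<partial>lborel)
      = (\<integral>\<^sup>+x. ennreal ((cmod (fourier (\<lambda>t. f t * exp (\<i> * w * of_real t)) (of_real x)))\<^sup>2) \<partial>lborel)"
    unfolding fourier_damped w_def Complex_eq ..
  also have "\<dots> \<le> ennreal (2 * pi) * (\<integral>\<^sup>+t. ennreal ((cmod (f t * exp (\<i> * w * of_real t)))\<^sup>2) \<partial>lborel)"
    using y by (intro fourier_bessel transformable_integrable f) (simp add: w_def)
  also have "\<dots> \<le> ennreal (2 * pi) * (\<integral>\<^sup>+t. ennreal ((cmod (f t))\<^sup>2) \<partial>lborel)"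
  proof (intro mult_left_mono nn_integral_mono ennreal_leI power_mono)
    fix t :: real
    show "cmod (f t * exp (\<i> * w * of_real t)) \<le> cmod (f t)"
      using transformable_zero[OF f, of t] y
      by (cases "t \<le> 0") (auto simp: norm_mult w_def intro!: mult_left_le)
  qed auto
  finally show ?thesis .
qed

lemma fourier_unique_on_line:
  assumes f: "integrable lborel (\<lambda>t. f t * exp (\<i> * w * of_real t))"
    and g: "integrable lborel (\<lambda>t. g t * exp (\<i> * w * of_real t))"
    and eq: "\<And>x::real. fourier f (of_real x + w) = fourier g (of_real x + w)"
  shows "AE t in lborel. f t = g t"
proof -
  let ?f = "\<lambda>t. f t * exp (\<i> * w * of_real t)" and ?g = "\<lambda>t. g t * exp (\<i> * w * of_real t)"
  have "AE t in lborel. ?f t - ?g t = 0"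
  proof (rule fourier_injective)
    show "integrable lborel (\<lambda>t. ?f t - ?g t)" using f g by simp
    fix x :: real
    have i: "integrable lborel (\<lambda>t. p t * exp (\<i> * of_real x * of_real t))" if "integrable lborel p" for p
      using that by (intro Bochner_Integration.integrable_bound[OF that]) (auto simp: norm_mult)
    have "fourier (\<lambda>t. ?f t - ?g t) (of_real x) = fourier ?f (of_real x) - fourier ?g (of_real x)"
      unfolding fourier_def left_diff_distrib
      by (rule Bochner_Integration.integral_diff) (use i[OF f] i[OF g] in simp_all)
    then show "fourier (\<lambda>t. ?f t - ?g t) (of_real x) = 0"
      by (simp add: fourier_damped eq)
  qed
  then show ?thesis by eventually_elim (simp flip: left_diff_distrib)
qed

section \<open>The Paley-Wiener theorem and the Hardy norm\<close>

text \<open>Apply the previous version at the heights \<open>a\<^sub>m = 1/(m+1)\<close>, obtaining \<open>f\<^sub>m\<close>. All the functions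
  \<open>g\<^sub>m(t) = exp(a\<^sub>m t) f\<^sub>m(t)\<close> have the transform \<open>F\<close> above height \<open>1\<close>, so they agree almost
  everywhere. The common function is the pointwise limit of the \<open>f\<^sub>m\<close>, and Fatou carries over
  the bound.\<close>

theorem Paley_Wiener:
  fixes F :: "complex \<Rightarrow> complex" and M :: real
  assumes F: "F holomorphic_on Cplus" and M0: "M > 0"
    and M: "\<And>y. y > 0 \<Longrightarrow> (\<integral>\<^sup>+x. ennreal ((cmod (F (Complex x y)))\<^sup>2) \<partial>lborel) \<le> ennreal M"
  obtains f where "f \<in> borel_measurable borel" "\<And>t. t \<le> 0 \<Longrightarrow> f t = 0"
    "(\<integral>\<^sup>+t. ennreal ((cmod (f t))\<^sup>2) \<partial>lborel) \<le> ennreal (M / (2 * pi))"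
    "\<And>z. z \<in> Cplus \<Longrightarrow> fourier f z = F z"
proof -
  define a where "a m = inverse (real (Suc m))" for m
  have a: "0 < a m" "a m \<le> 1" for m by (auto simp: a_def field_simps)
  have alim: "a \<longlonglongrightarrow> 0" unfolding a_def by (rule LIMSEQ_inverse_real_of_nat)
  have "\<forall>m. \<exists>f. f \<in> borel_measurable borel \<and> (\<forall>t\<le>0. f t = 0) \<and>
    (\<integral>\<^sup>+t. ennreal ((cmod (f t))\<^sup>2) \<partial>lborel) \<le> ennreal (M / (2 * pi)) \<and>
    (\<forall>z. Im z > 0 \<longrightarrow> fourier f z = F (z + \<i> * a m))"
  proof
    fix m
    show "\<exists>f. f \<in> borel_measurable borel \<and> (\<forall>t\<le>0. f t = 0) \<and>
      (\<integral>\<^sup>+t. ennreal ((cmod (f t))\<^sup>2) \<partial>lborel) \<le> ennreal (M / (2 * pi)) \<and>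
      (\<forall>z. Im z > 0 \<longrightarrow> fourier f z = F (z + \<i> * a m))"
      by (rule Paley_Wiener_at_height[OF F M0 M a(1)[of m]]) auto
  qed
  then obtain f where f: "\<And>m. f m \<in> borel_measurable borel" "\<And>m t. t \<le> 0 \<Longrightarrow> f m t = 0"
    "\<And>m. (\<integral>\<^sup>+t. ennreal ((cmod (f m t))\<^sup>2) \<partial>lborel) \<le> ennreal (M / (2 * pi))"
    "\<And>m z. Im z > 0 \<Longrightarrow> fourier (f m) z = F (z + \<i> * a m)"
    by metis
  note [measurable] = f(1)
  have tf: "transformable (f m)" for m
    by (rule transformable_of_square_integrable[OF f(1,2)]) (use le_less_trans[OF f(3)] in auto)
  define g where "g m t = f m t * exp (\<i> * (- \<i> * of_real (a m)) * of_real t)" for m t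
  have [measurable]: "g m \<in> borel_measurable borel" for m unfolding g_def[abs_def] by measurable
  have gF: "fourier (g m) z = F z" if "Im z > a m" for m z
    unfolding g_def[abs_def] fourier_damped using f(4)[of "z + - \<i> * of_real (a m)" m] that by simp
  \<comment> \<open>The line \<open>Im z = 2\<close> lies above all the heights \<open>a m \<le> 1\<close>.\<close>
  define w where "w = \<i> * (2::complex)"
  have gi: "integrable lborel (\<lambda>t. g m t * exp (\<i> * w * of_real t))" for m
  proof -
    have "integrable lborel (\<lambda>t. f m t * exp (\<i> * (- \<i> * of_real (a m) + w) * of_real t))"
      by (rule transformable_integrable[OF tf]) (use a[of m] in \<open>simp add: w_def\<close>)
    also have "(\<lambda>t. f m t * exp (\<i> * (- \<i> * of_real (a m) + w) * of_real t)) = (\<lambda>t. g m t * exp (\<i> * w * of_real t))"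
      unfolding g_def fun_eq_iff by (simp add: algebra_simps flip: exp_add)
    finally show ?thesis .
  qed
  have "AE t in lborel. g 0 t = g m t" for m
  proof (rule fourier_unique_on_line[OF gi gi])
    show "fourier (g 0) (of_real x + w) = fourier (g m) (of_real x + w)" for x :: real
      using a[of 0] a[of m] by (subst (1 2) gF) (auto simp: w_def)
  qed
  then have ae: "AE t in lborel. \<forall>m. g 0 t = g m t" by (simp add: AE_all_countable)
  have "(\<integral>\<^sup>+t. ennreal ((cmod (g 0 t))\<^sup>2) \<partial>lborel) = (\<integral>\<^sup>+t. liminf (\<lambda>m. ennreal ((cmod (f m t))\<^sup>2)) \<partial>lborel)"
  proof (rule nn_integral_cong_AE, use ae in eventually_elim)
    case (elim t)
    have "f m t = g 0 t * exp (- of_real (a m * t))" for m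
    proof -
      have "f m t = g m t * exp (- of_real (a m * t))"
        unfolding g_def by (simp add: mult.assoc flip: exp_add)
      then show ?thesis using elim by metis
    qed
    moreover have "(\<lambda>m. ennreal ((cmod (g 0 t * exp (- of_real (a m * t))))\<^sup>2)) \<longlonglongrightarrow> ennreal ((cmod (g 0 t * exp (- of_real (0 * t))))\<^sup>2)"
      by (intro tendsto_ennrealI tendsto_intros alim)
    ultimately show ?case by (intro lim_imp_Liminf[symmetric]) auto
  qed
  also have "\<dots> \<le> liminf (\<lambda>m. \<integral>\<^sup>+t. ennreal ((cmod (f m t))\<^sup>2) \<partial>lborel)"
    by (rule nn_integral_liminf) measurable
  also have "\<dots> \<le> ennreal (M / (2 * pi))"
    by (rule Liminf_le, simp) (intro always_eventually allI f(3))
  finally have g2: "(\<integral>\<^sup>+t. ennreal ((cmod (g 0 t))\<^sup>2) \<partial>lborel) \<le> ennreal (M / (2 * pi))" .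
  have "fourier (g 0) z = F z" if "z \<in> Cplus" for z
  proof -
    have "\<forall>\<^sub>F m in sequentially. a m < Im z"
      using that by (intro order_tendstoD(2)[OF alim]) (simp add: Cplus_def)
    then obtain m where m: "a m < Im z" by (auto simp: eventually_sequentially)
    have "fourier (g 0) z = fourier (g m) z"
      unfolding fourier_def by (rule integral_cong_AE) (use ae in \<open>auto elim: eventually_mono\<close>)
    then show ?thesis using gF[OF m] by simp
  qed
  moreover have "g 0 t = 0" if "t \<le> 0" for t using f(2)[OF that] by (simp add: g_def)
  ultimately show ?thesis using g2 by (intro that) auto
qed

lemma esqrt_le_iff:
  assumes "s \<ge> 0"
  shows "esqrt a \<le> ennreal s \<longleftrightarrow> a \<le> ennreal (s\<^sup>2)"
proof (cases "a = top")
  case False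
  define r where "r = enn2real a"
  have r: "a = ennreal r" "r \<ge> 0" using False by (auto simp: r_def less_top)
  have "sqrt r \<le> s \<longleftrightarrow> r \<le> s\<^sup>2"
    using assms r(2) real_sqrt_le_iff[of r "s\<^sup>2"] by simp
  then show ?thesis using r assms by (simp add: esqrt_def ennreal_le_iff)
qed (simp add: esqrt_def top_unique)

lemma esqrt_top [simp]: "esqrt top = top"
  by (simp add: esqrt_def)

lemma esqrt_mono: "a \<le> b \<Longrightarrow> esqrt a \<le> esqrt b"
  by (auto simp: esqrt_def top_unique less_top intro!: ennreal_leI enn2real_mono)

lemma esqrt_power2 [simp]: "(esqrt a)\<^sup>2 = a"
  by (auto simp: esqrt_def less_top ennreal_power)

text \<open>One inequality is Bessel's. If the Hardy norm is a finite number \<open>s\<close>, then Paley-Wiener with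
  \<open>M = s\<^sup>2 + e\<close> represents the same transform by some \<open>h\<close> with \<open>2\<pi> \<integral>|h|\<^sup>2 \<le> s\<^sup>2 + e\<close>; by
  uniqueness \<open>h = f\<close> almost everywhere, and \<open>e > 0\<close> is arbitrary. Since no integrability of \<open>|f|\<^sup>2\<close>
  is assumed, the identity also detects which transforms have derivatives in the Hardy space.\<close>

theorem hardy_norm_fourier:
  assumes f: "transformable f" and G: "\<And>z. z \<in> Cplus \<Longrightarrow> G z = fourier f z"
  shows "hardy_norm G = esqrt (ennreal (2 * pi) * (\<integral>\<^sup>+t. ennreal ((cmod (f t))\<^sup>2) \<partial>lborel))"
proof (rule antisym)
  let ?I = "\<integral>\<^sup>+t. ennreal ((cmod (f t))\<^sup>2) \<partial>lborel"
  show "hardy_norm G \<le> esqrt (ennreal (2 * pi) * ?I)"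
    unfolding hardy_norm_def
  proof (rule SUP_least)
    fix y :: real assume "y \<in> {0<..}"
    then show "esqrt (\<integral>\<^sup>+x. ennreal ((cmod (G (Complex x y)))\<^sup>2) \<partial>lborel) \<le> esqrt (ennreal (2 * pi) * ?I)"
      using fourier_line_bound[OF f, of y] by (intro esqrt_mono) (simp add: G Cplus_def)
  qed
  show "esqrt (ennreal (2 * pi) * ?I) \<le> hardy_norm G"
  proof (cases "hardy_norm G = top")
    case False
    define s where "s = enn2real (hardy_norm G)"
    have s: "hardy_norm G = ennreal s" "s \<ge> 0" using False by (auto simp: s_def less_top)
    have line: "(\<integral>\<^sup>+x. ennreal ((cmod (G (Complex x y)))\<^sup>2) \<partial>lborel) \<le> ennreal (s\<^sup>2)" if "y > 0" for y
    proof -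
      have "esqrt (\<integral>\<^sup>+x. ennreal ((cmod (G (Complex x y)))\<^sup>2) \<partial>lborel) \<le> hardy_norm G"
        unfolding hardy_norm_def by (rule SUP_upper) (use that in simp)
      then show ?thesis using s by (simp add: esqrt_le_iff)
    qed
    have "ennreal (2 * pi) * ?I \<le> ennreal (s\<^sup>2)"
    proof (rule ennreal_le_epsilon)
      fix e :: real assume e: "e > 0"
      have pos: "s\<^sup>2 + e > 0" using e by (simp add: add_nonneg_pos)
      have bd: "(\<integral>\<^sup>+x. ennreal ((cmod (G (Complex x y)))\<^sup>2) \<partial>lborel) \<le> ennreal (s\<^sup>2 + e)" if "y > 0" for y
        using e by (intro order_trans[OF line[OF that]] ennreal_leI) simp
      show "ennreal (2 * pi) * ?I \<le> ennreal (s\<^sup>2) + ennreal e"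
      proof (rule Paley_Wiener[OF fourier_holomorphic[OF f G] pos bd])
        fix h assume h: "h \<in> borel_measurable borel" "\<And>t. t \<le> 0 \<Longrightarrow> h t = 0"
          "(\<integral>\<^sup>+t. ennreal ((cmod (h t))\<^sup>2) \<partial>lborel) \<le> ennreal ((s\<^sup>2 + e) / (2 * pi))"
          "\<And>z. z \<in> Cplus \<Longrightarrow> fourier h z = G z"
        have th: "transformable h"
          by (rule transformable_of_square_integrable[OF h(1,2)]) (use le_less_trans[OF h(3)] in auto)
        have "AE t in lborel. f t = h t"
          by (rule fourier_unique_on_line[OF transformable_integrable[OF f] transformable_integrable[OF th], where w = \<i>])
             (use h(4) G in \<open>auto simp: Cplus_def\<close>)
        then have "?I = (\<integral>\<^sup>+t. ennreal ((cmod (h t))\<^sup>2) \<partial>lborel)"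
          by (intro nn_integral_cong_AE) (auto elim: eventually_mono)
        then have "ennreal (2 * pi) * ?I \<le> ennreal (2 * pi) * ennreal ((s\<^sup>2 + e) / (2 * pi))"
          using h(3) by (intro mult_left_mono) auto
        also have "\<dots> = ennreal (s\<^sup>2 + e)"
          using e by (subst ennreal_mult[symmetric]) auto
        finally show "ennreal (2 * pi) * ?I \<le> ennreal (s\<^sup>2) + ennreal e"
          using e by simp
      qed
    qed
    then show ?thesis using s by (simp add: esqrt_le_iff)
  qed simp
qed

section \<open>Passage to the weighted spaces and their classes\<close>

lemma borel_measurable_lebesgue_on:
  "f \<in> borel_measurable borel \<Longrightarrow> f \<in> borel_measurable (lebesgue_on S)"
  by (intro measurable_restrict_space1 measurable_completion) simp

lemma ident_measurable_lebesgue_on: "(\<lambda>x::real. x) \<in> borel_measurable (lebesgue_on S)"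
  by (rule borel_measurable_lebesgue_on) simp

text \<open>The spaces consist of Lebesgue measurable functions that are arbitrary outside the half-line, while
  Fubini's theorem above is used for the Borel measure on the line. A Borel version that vanishes
  on \<open>(-\<infinity>, 0]\<close> connects the two.\<close>

definition borel_rep :: "(real \<Rightarrow> complex) \<Rightarrow> (real \<Rightarrow> complex) \<Rightarrow> bool" where
  "borel_rep f g \<longleftrightarrow> g \<in> borel_measurable borel \<and> (\<forall>t\<le>0. g t = 0) \<and> (AE x in lebesgue_on {0<..}. f x = g x)"

lemma AE_lebesgue_on_iff:
  "(AE x in lebesgue_on {0<..}. P x) \<longleftrightarrow> (AE x in lborel. x > (0::real) \<longrightarrow> P x)"
  by (simp add: AE_restrict_space_iff AE_completion_iff)

lemma borel_rep_exists:
  assumes f: "f \<in> borel_measurable (lebesgue_on {0<..})"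
  shows "\<exists>g. borel_rep f g"
proof -
  define h where "h x = indicator {0<..} x *\<^sub>R f x" for x
  have [measurable]: "h \<in> borel_measurable lebesgue"
    using f unfolding h_def[abs_def] by (subst (asm) borel_measurable_restrict_space_iff) auto
  obtain u where u: "u \<in> borel_measurable lborel" "AE x in lborel. Re (h x) = u x"
    using completion_ex_borel_measurable_real[of "\<lambda>x. Re (h x)" lborel] by auto
  obtain v where v: "v \<in> borel_measurable lborel" "AE x in lborel. Im (h x) = v x"
    using completion_ex_borel_measurable_real[of "\<lambda>x. Im (h x)" lborel] by auto
  have [measurable]: "u \<in> borel_measurable borel" "v \<in> borel_measurable borel" using u v by auto
  define g where "g x = indicator {0<..} x *\<^sub>R Complex (u x) (v x)" for x
  have "g \<in> borel_measurable borel" unfolding g_def[abs_def] Complex_eq by measurable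
  moreover have "AE x in lborel. x > 0 \<longrightarrow> f x = g x"
    using u(2) v(2) by eventually_elim (auto simp: g_def h_def complex_eq_iff)
  ultimately have "borel_rep f g"
    unfolding borel_rep_def AE_lebesgue_on_iff by (simp add: g_def)
  then show ?thesis by blast
qed

lemma weighted_norm_rep:
  assumes rep: "borel_rep f g"
  shows "(\<integral>\<^sup>+x. ennreal ((cmod (f x))\<^sup>2 * (2 * pi * x ^ (2 * k))) \<partial>lebesgue_on {0<..})
      = ennreal (2 * pi) * (\<integral>\<^sup>+t. ennreal ((cmod ((\<i> * of_real t) ^ k * g t))\<^sup>2) \<partial>lborel)"
proof -
  have [measurable]: "g \<in> borel_measurable borel" and g0: "\<And>t. t \<le> 0 \<Longrightarrow> g t = 0"
    and ae: "AE x in lebesgue_on {0<..}. f x = g x"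
    using rep by (auto simp: borel_rep_def)
  have "(\<integral>\<^sup>+x. ennreal ((cmod (f x))\<^sup>2 * (2 * pi * x ^ (2 * k))) \<partial>lebesgue_on {0<..})
     = (\<integral>\<^sup>+x. ennreal ((cmod (g x))\<^sup>2 * (2 * pi * x ^ (2 * k))) \<partial>lebesgue_on {0<..})"
    by (rule nn_integral_cong_AE) (use ae in \<open>auto elim: eventually_mono\<close>)
  also have "\<dots> = (\<integral>\<^sup>+x. ennreal ((cmod (g x))\<^sup>2 * (2 * pi * x ^ (2 * k))) * indicator {0<..} x \<partial>lborel)"
    by (simp add: nn_integral_restrict_space nn_integral_completion)
  also have "\<dots> = (\<integral>\<^sup>+t. ennreal (2 * pi) * ennreal ((cmod ((\<i> * of_real t) ^ k * g t))\<^sup>2) \<partial>lborel)"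
  proof (rule nn_integral_cong)
    fix t :: real
    have "(cmod ((\<i> * of_real t) ^ k * g t))\<^sup>2 = t ^ (2 * k) * (cmod (g t))\<^sup>2"
      by (simp add: norm_mult norm_power power_mult_distrib power_even_abs flip: power_mult)
         (simp add: mult.commute power_even_abs)
    then show "ennreal ((cmod (g t))\<^sup>2 * (2 * pi * t ^ (2 * k))) * indicator {0<..} t
       = ennreal (2 * pi) * ennreal ((cmod ((\<i> * of_real t) ^ k * g t))\<^sup>2)"
      using g0[of t] by (cases "t \<le> 0") (auto simp: mult_ac simp flip: ennreal_mult)
  qed
  also have "\<dots> = ennreal (2 * pi) * (\<integral>\<^sup>+t. ennreal ((cmod ((\<i> * of_real t) ^ k * g t))\<^sup>2) \<partial>lborel)"
    by (rule nn_integral_cmult) measurable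
  finally show ?thesis .
qed

lemma hol_fourier_rep:
  assumes f: "f \<in> borel_measurable (lebesgue_on {0<..})" and rep: "borel_rep f g" and g: "transformable g"
    and z: "z \<in> Cplus"
  shows "integrable (lebesgue_on {0<..}) (\<lambda>x. f x * exp (\<i> * z * of_real x))"
    and "hol_fourier f z = fourier g z"
proof -
  have gm: "g \<in> borel_measurable borel" and g0: "\<And>t. t \<le> 0 \<Longrightarrow> g t = 0"
    and ae: "AE x in lebesgue_on {0<..}. f x = g x"
    using rep by (auto simp: borel_rep_def)
  note [measurable] = f borel_measurable_lebesgue_on[OF gm] gm ident_measurable_lebesgue_on[of "{0<..}"]
  have i: "integrable lborel (\<lambda>x. g x * exp (\<i> * z * of_real x))"
    using z by (intro transformable_integrable g) (simp add: Cplus_def)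
  have ind: "indicator {0<..} x *\<^sub>R (g x * exp (\<i> * z * of_real x)) = g x * exp (\<i> * z * of_real x)" for x
    using g0[of x] by (auto simp: indicator_def)
  have i': "integrable (lebesgue_on {0<..}) (\<lambda>x. g x * exp (\<i> * z * of_real x))"
    by (subst integrable_restrict_space) (use i in \<open>auto simp: ind set_integrable_def integrable_completion\<close>)
  have ae': "AE x in lebesgue_on {0<..}. g x * exp (\<i> * z * of_real x) = f x * exp (\<i> * z * of_real x)"
    using ae by eventually_elim simp
  show "integrable (lebesgue_on {0<..}) (\<lambda>x. f x * exp (\<i> * z * of_real x))"
    by (rule Bochner_Integration.integrable_cong_AE_imp[OF i' _ ae']) measurable
  have "hol_fourier f z = (LINT x|lebesgue_on {0<..}. f x * exp (\<i> * z * of_real x))"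
    using z by (simp add: hol_fourier_def)
  also have "\<dots> = (LINT x|lebesgue_on {0<..}. g x * exp (\<i> * z * of_real x))"
    by (rule integral_cong_AE) (use ae' in \<open>auto elim: eventually_mono\<close>)
  also have "\<dots> = (LINT x|lebesgue. indicator {0<..} x *\<^sub>R (g x * exp (\<i> * z * of_real x)))"
    by (subst integral_restrict_space) auto
  also have "\<dots> = fourier g z"
    unfolding ind fourier_def by (rule integral_completion) simp
  finally show "hol_fourier f z = fourier g z" .
qed

lemma esqrt_less_top_iff: "esqrt a < top \<longleftrightarrow> a < top"
  by (auto simp: esqrt_def less_top[symmetric])

lemma L2_fun_iff:
  "f \<in> L2_fun n \<longleftrightarrow> f \<in> borel_measurable (lebesgue_on {0<..}) \<and>
     (\<forall>k\<le>n. (\<integral>\<^sup>+x. ennreal ((cmod (f x))\<^sup>2 * (2 * pi * x ^ (2 * k))) \<partial>lebesgue_on {0<..}) < top)"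
  by (auto simp: L2_fun_def L2_fun_norm_def esqrt_less_top_iff ennreal_sum_less_top)

lemma L2_fun_rep:
  assumes f: "f \<in> L2_fun n"
  obtains g where "borel_rep f g" "transformable g"
proof -
  have m: "f \<in> borel_measurable (lebesgue_on {0<..})" using f by (simp add: L2_fun_iff)
  obtain g where g: "borel_rep f g" using borel_rep_exists[OF m] ..
  have "ennreal (2 * pi) * (\<integral>\<^sup>+t. ennreal ((cmod (g t))\<^sup>2) \<partial>lborel) < top"
    using f weighted_norm_rep[OF g, of 0] by (auto simp: L2_fun_iff)
  then have "(\<integral>\<^sup>+t. ennreal ((cmod (g t))\<^sup>2) \<partial>lborel) < \<infinity>"
    by (auto simp: ennreal_mult_less_top)
  then have "transformable g"
    using g by (intro transformable_of_square_integrable) (auto simp: borel_rep_def)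
  with g show ?thesis by (rule that)
qed

lemma H2_norm_fourier:
  assumes rep: "borel_rep f g" and g: "transformable g" and G: "\<And>z. z \<in> Cplus \<Longrightarrow> G z = fourier g z"
  shows "(hardy_norm ((deriv ^^ k) G))\<^sup>2 = (\<integral>\<^sup>+x. ennreal ((cmod (f x))\<^sup>2 * (2 * pi * x ^ (2 * k))) \<partial>lebesgue_on {0<..})"
  using hardy_norm_fourier[OF transformable_mult_power[OF g] higher_deriv_fourier[OF g G], of k]
  by (simp add: weighted_norm_rep[OF rep])

lemma hol_fourier_in_H2:
  assumes f: "f \<in> L2_fun n"
  shows "hol_fourier f \<in> vecs (H2 n)"
    and "vnorm (H2 n) (hol_fourier f) = enn2real (L2_fun_norm n f)"
proof -
  have m: "f \<in> borel_measurable (lebesgue_on {0<..})" using f by (simp add: L2_fun_iff)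
  obtain g where rep: "borel_rep f g" and g: "transformable g" by (rule L2_fun_rep[OF f])
  have G: "hol_fourier f z = fourier g z" if "z \<in> Cplus" for z
    by (rule hol_fourier_rep(2)[OF m rep g that])
  have norm: "(hardy_norm ((deriv ^^ k) (hol_fourier f)))\<^sup>2
      = (\<integral>\<^sup>+x. ennreal ((cmod (f x))\<^sup>2 * (2 * pi * x ^ (2 * k))) \<partial>lebesgue_on {0<..})" for k
    by (rule H2_norm_fourier[OF rep g G])
  have hol: "hol_fourier f holomorphic_on Cplus"
    by (rule fourier_holomorphic[OF g G])
  have "in_hardy ((deriv ^^ k) (hol_fourier f))" if "k \<le> n" for k
  proof -
    have "(hardy_norm ((deriv ^^ k) (hol_fourier f)))\<^sup>2 < top"
      using f that unfolding norm by (simp add: L2_fun_iff)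
    then have "hardy_norm ((deriv ^^ k) (hol_fourier f)) < top"
      by (simp add: power_less_top_ennreal)
    then show ?thesis
      unfolding in_hardy_def by (intro conjI holomorphic_higher_deriv[OF hol open_Cplus])
  qed
  then show "hol_fourier f \<in> vecs (H2 n)"
    using hol by (simp add: H2_def hol_fourier_def)
  show "vnorm (H2 n) (hol_fourier f) = enn2real (L2_fun_norm n f)"
    by (simp add: H2_def norm L2_fun_norm_def)
qed

text \<open>The \<open>L\<^sup>2\<close> preimage under the transform comes from \<open>F\<close> alone. That it lies in the weighted space
  follows from \<open>H2_norm_fourier\<close>, read from left to right for each derivative.\<close>

lemma hol_fourier_surj:
  assumes F: "F \<in> vecs (H2 n)"
  shows "\<exists>f\<in>L2_fun n. hol_fourier f = F"
proof -
  have hol: "F holomorphic_on Cplus" and F0: "\<And>z. z \<notin> Cplus \<Longrightarrow> F z = 0"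
    and hardy: "\<And>k. k \<le> n \<Longrightarrow> hardy_norm ((deriv ^^ k) F) < top"
    using F by (auto simp: H2_def in_hardy_def)
  define s where "s = enn2real (hardy_norm F)"
  have s: "hardy_norm F = ennreal s" "s \<ge> 0" using hardy[of 0] by (auto simp: s_def)
  have pos: "s\<^sup>2 + 1 > 0" by (simp add: add_nonneg_pos)
  have line: "(\<integral>\<^sup>+x. ennreal ((cmod (F (Complex x y)))\<^sup>2) \<partial>lborel) \<le> ennreal (s\<^sup>2 + 1)" if "y > 0" for y
  proof -
    have "esqrt (\<integral>\<^sup>+x. ennreal ((cmod (F (Complex x y)))\<^sup>2) \<partial>lborel) \<le> ennreal s"
      unfolding s(1)[symmetric] hardy_norm_def by (rule SUP_upper) (use that in simp)
    then have "(\<integral>\<^sup>+x. ennreal ((cmod (F (Complex x y)))\<^sup>2) \<partial>lborel) \<le> ennreal (s\<^sup>2)"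
      using s by (simp add: esqrt_le_iff)
    also have "\<dots> \<le> ennreal (s\<^sup>2 + 1)" by (intro ennreal_leI) simp
    finally show ?thesis .
  qed
  show ?thesis
  proof (rule Paley_Wiener[OF hol pos line])
    fix f assume f: "f \<in> borel_measurable borel" "\<And>t. t \<le> 0 \<Longrightarrow> f t = 0"
      "(\<integral>\<^sup>+t. ennreal ((cmod (f t))\<^sup>2) \<partial>lborel) \<le> ennreal ((s\<^sup>2 + 1) / (2 * pi))"
      "\<And>z. z \<in> Cplus \<Longrightarrow> fourier f z = F z"
    have tf: "transformable f"
      by (rule transformable_of_square_integrable[OF f(1,2)]) (use le_less_trans[OF f(3)] in auto)
    have rep: "borel_rep f f" using f(1,2) by (simp add: borel_rep_def)
    have m: "f \<in> borel_measurable (lebesgue_on {0<..})"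
      by (rule borel_measurable_lebesgue_on[OF f(1)])
    have "f \<in> L2_fun n"
      unfolding L2_fun_iff
    proof (intro conjI m allI impI)
      fix k assume "k \<le> n"
      then have "(hardy_norm ((deriv ^^ k) F))\<^sup>2 < top"
        using hardy[of k] by (simp add: power_less_top_ennreal)
      moreover have "(hardy_norm ((deriv ^^ k) F))\<^sup>2 = (\<integral>\<^sup>+x. ennreal ((cmod (f x))\<^sup>2 * (2 * pi * x ^ (2 * k))) \<partial>lebesgue_on {0<..})"
        by (rule H2_norm_fourier[OF rep tf]) (rule f(4)[symmetric])
      ultimately show "(\<integral>\<^sup>+x. ennreal ((cmod (f x))\<^sup>2 * (2 * pi * x ^ (2 * k))) \<partial>lebesgue_on {0<..}) < top"
        by simp
    qed
    moreover have "hol_fourier f = F"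
    proof
      fix z
      show "hol_fourier f z = F z"
        using hol_fourier_rep(2)[OF m rep tf, of z] f(4)[of z] F0[of z]
        by (cases "z \<in> Cplus") (auto simp: hol_fourier_def)
    qed
    ultimately show ?thesis by blast
  qed
qed

lemma hol_fourier_cong_AE:
  assumes "f \<in> borel_measurable (lebesgue_on {0<..})" "g \<in> borel_measurable (lebesgue_on {0<..})"
    and "AE x in lebesgue_on {0<..}. f x = g x"
  shows "hol_fourier f = hol_fourier g"
proof
  fix z
  note [measurable] = assms(1,2) borel_measurable_lebesgue_on[of "\<lambda>x. exp (\<i> * z * complex_of_real x)"]
  have "(LINT x|lebesgue_on {0<..}. f x * exp (\<i> * z * of_real x)) = (LINT x|lebesgue_on {0<..}. g x * exp (\<i> * z * of_real x))"
    by (rule integral_cong_AE) (use assms(3) in \<open>auto elim: eventually_mono\<close>)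
  then show "hol_fourier f z = hol_fourier g z" by (simp add: hol_fourier_def)
qed

lemma hol_fourier_inj:
  assumes f: "f \<in> L2_fun n" and g: "g \<in> L2_fun n" and eq: "hol_fourier f = hol_fourier g"
  shows "AE x in lebesgue_on {0<..}. f x = g x"
proof -
  have fm: "f \<in> borel_measurable (lebesgue_on {0<..})" and gm: "g \<in> borel_measurable (lebesgue_on {0<..})"
    using f g by (auto simp: L2_fun_iff)
  obtain f' where f': "borel_rep f f'" "transformable f'" by (rule L2_fun_rep[OF f])
  obtain g' where g': "borel_rep g g'" "transformable g'" by (rule L2_fun_rep[OF g])
  have "AE t in lborel. f' t = g' t"
  proof (rule fourier_unique_on_line[OF transformable_integrable[OF f'(2)] transformable_integrable[OF g'(2)], where w = \<i>])
    fix x :: real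
    have "of_real x + \<i> \<in> Cplus" by (simp add: Cplus_def)
    then show "fourier f' (of_real x + \<i>) = fourier g' (of_real x + \<i>)"
      using hol_fourier_rep(2)[OF fm f'] hol_fourier_rep(2)[OF gm g'] eq by metis
  qed auto
  then have "AE x in lebesgue_on {0<..}. f' x = g' x"
    unfolding AE_lebesgue_on_iff by (auto elim: eventually_mono)
  moreover have "AE x in lebesgue_on {0<..}. f x = f' x" "AE x in lebesgue_on {0<..}. g x = g' x"
    using f'(1) g'(1) by (auto simp: borel_rep_def)
  ultimately show ?thesis by eventually_elim simp
qed

lemma L2_fun_measurable: "f \<in> L2_fun n \<Longrightarrow> f \<in> borel_measurable (lebesgue_on {0<..})"
  by (simp add: L2_fun_iff)

lemma hol_fourier_integrable:
  assumes "f \<in> L2_fun n" "z \<in> Cplus"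
  shows "integrable (lebesgue_on {0<..}) (\<lambda>x. f x * exp (\<i> * z * of_real x))"
  using L2_fun_rep[OF assms(1)] hol_fourier_rep(1)[OF L2_fun_measurable[OF assms(1)] _ _ assms(2)] by metis

lemma ennreal_double_add: "p \<ge> 0 \<Longrightarrow> q \<ge> 0 \<Longrightarrow> ennreal (2 * (p + q)) = 2 * (ennreal p + ennreal q)"
  by (simp add: ennreal_mult ennreal_plus)

lemma L2_fun_add:
  assumes f: "f \<in> L2_fun n" and g: "g \<in> L2_fun n"
  shows "(\<lambda>x. f x + g x) \<in> L2_fun n"
  unfolding L2_fun_iff
proof (intro conjI allI impI)
  note [measurable] = f[THEN L2_fun_measurable] g[THEN L2_fun_measurable] ident_measurable_lebesgue_on[of "{0<..}"]
  show "(\<lambda>x. f x + g x) \<in> borel_measurable (lebesgue_on {0<..})" by measurable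
  fix k assume k: "k \<le> n"
  let ?w = "\<lambda>x::real. 2 * pi * x ^ (2 * k)"
  have "(\<integral>\<^sup>+x. ennreal ((cmod (f x + g x))\<^sup>2 * ?w x) \<partial>lebesgue_on {0<..})
     \<le> (\<integral>\<^sup>+x. 2 * (ennreal ((cmod (f x))\<^sup>2 * ?w x) + ennreal ((cmod (g x))\<^sup>2 * ?w x)) \<partial>lebesgue_on {0<..})"
  proof (rule nn_integral_mono)
    fix x
    have w: "?w x \<ge> 0" by simp
    have "(cmod (f x + g x))\<^sup>2 \<le> (cmod (f x) + cmod (g x))\<^sup>2"
      by (intro power_mono norm_triangle_ineq) auto
    also have "\<dots> \<le> 2 * ((cmod (f x))\<^sup>2 + (cmod (g x))\<^sup>2)"
      using sum_squares_bound[of "cmod (f x)" "cmod (g x)"] by (simp add: power2_sum)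
    finally have "(cmod (f x + g x))\<^sup>2 * ?w x \<le> 2 * ((cmod (f x))\<^sup>2 + (cmod (g x))\<^sup>2) * ?w x"
      using w by (rule mult_right_mono)
    then have "ennreal ((cmod (f x + g x))\<^sup>2 * ?w x) \<le> ennreal (2 * ((cmod (f x))\<^sup>2 * ?w x + (cmod (g x))\<^sup>2 * ?w x))"
      by (intro ennreal_leI) (simp only: algebra_simps)
    also have "\<dots> = 2 * (ennreal ((cmod (f x))\<^sup>2 * ?w x) + ennreal ((cmod (g x))\<^sup>2 * ?w x))"
      by (rule ennreal_double_add) (use w in auto)
    finally show "ennreal ((cmod (f x + g x))\<^sup>2 * ?w x) \<le> 2 * (ennreal ((cmod (f x))\<^sup>2 * ?w x) + ennreal ((cmod (g x))\<^sup>2 * ?w x))" .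
  qed
  also have "\<dots> = 2 * ((\<integral>\<^sup>+x. ennreal ((cmod (f x))\<^sup>2 * ?w x) \<partial>lebesgue_on {0<..}) + (\<integral>\<^sup>+x. ennreal ((cmod (g x))\<^sup>2 * ?w x) \<partial>lebesgue_on {0<..}))"
    by (simp add: nn_integral_cmult nn_integral_add)
  also have "\<dots> < top"
    using f g k by (auto simp: L2_fun_iff ennreal_mult_less_top)
  finally show "(\<integral>\<^sup>+x. ennreal ((cmod (f x + g x))\<^sup>2 * ?w x) \<partial>lebesgue_on {0<..}) < top" .
qed

lemma L2_fun_scale:
  assumes f: "f \<in> L2_fun n"
  shows "(\<lambda>x. c * f x) \<in> L2_fun n"
  unfolding L2_fun_iff
proof (intro conjI allI impI)
  note [measurable] = f[THEN L2_fun_measurable] ident_measurable_lebesgue_on[of "{0<..}"]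
  show "(\<lambda>x. c * f x) \<in> borel_measurable (lebesgue_on {0<..})" by measurable
  fix k assume k: "k \<le> n"
  let ?w = "\<lambda>x::real. 2 * pi * x ^ (2 * k)"
  have "(\<integral>\<^sup>+x. ennreal ((cmod (c * f x))\<^sup>2 * ?w x) \<partial>lebesgue_on {0<..})
     = (\<integral>\<^sup>+x. ennreal ((cmod c)\<^sup>2) * ennreal ((cmod (f x))\<^sup>2 * ?w x) \<partial>lebesgue_on {0<..})"
    by (intro nn_integral_cong) (simp add: norm_mult power_mult_distrib mult.assoc flip: ennreal_mult)
  also have "\<dots> = ennreal ((cmod c)\<^sup>2) * (\<integral>\<^sup>+x. ennreal ((cmod (f x))\<^sup>2 * ?w x) \<partial>lebesgue_on {0<..})"
    by (rule nn_integral_cmult) measurable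
  also have "\<dots> < top"
    using f k by (auto simp: L2_fun_iff ennreal_mult_less_top)
  finally show "(\<integral>\<^sup>+x. ennreal ((cmod (c * f x))\<^sup>2 * ?w x) \<partial>lebesgue_on {0<..}) < top" .
qed

lemma hol_fourier_add:
  assumes f: "f \<in> L2_fun n" and g: "g \<in> L2_fun n"
  shows "hol_fourier (\<lambda>x. f x + g x) = (\<lambda>z. hol_fourier f z + hol_fourier g z)"
  using hol_fourier_integrable[OF f] hol_fourier_integrable[OF g]
  by (auto simp: hol_fourier_def fun_eq_iff distrib_right)

lemma hol_fourier_scale: "hol_fourier (\<lambda>x. c * f x) = (\<lambda>z. c * hol_fourier f z)"
  by (auto simp: hol_fourier_def fun_eq_iff mult.assoc)

lemma equiv_ae_rel: "equiv (L2_fun n) (ae_rel n)"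
proof (rule equivI)
  show "refl_on (L2_fun n) (ae_rel n)" by (auto simp: refl_on_def ae_rel_def)
  show "sym (ae_rel n)" by (rule symI) (auto simp: ae_rel_def elim: eventually_mono)
  show "trans (ae_rel n)"
  proof (rule transI)
    fix f g h assume "(f, g) \<in> ae_rel n" "(g, h) \<in> ae_rel n"
    then show "(f, h) \<in> ae_rel n"
      unfolding ae_rel_def by (auto elim: eventually_elim2)
  qed
qed (auto simp: ae_rel_def)

lemma ae_rel_add:
  assumes "(f, f') \<in> ae_rel n" "(g, g') \<in> ae_rel n"
  shows "((\<lambda>x. f x + g x), (\<lambda>x. f' x + g' x)) \<in> ae_rel n"
  using assms by (auto simp: ae_rel_def L2_fun_add elim: eventually_elim2)

lemma ae_rel_scale:
  assumes "(f, f') \<in> ae_rel n"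
  shows "((\<lambda>x. c * f x), (\<lambda>x. c * f' x)) \<in> ae_rel n"
  using assms by (auto simp: ae_rel_def L2_fun_scale elim: eventually_mono)

lemma hol_fourier_ae_rel: "(f, g) \<in> ae_rel n \<Longrightarrow> hol_fourier f = hol_fourier g"
  by (auto simp: ae_rel_def intro: hol_fourier_cong_AE L2_fun_measurable)

lemma L2_fun_norm_ae_rel: "(f, g) \<in> ae_rel n \<Longrightarrow> L2_fun_norm n f = L2_fun_norm n g"
  unfolding L2_fun_norm_def
  by (intro arg_cong[where f = esqrt] sum.cong refl nn_integral_cong_AE) (auto simp: ae_rel_def elim: eventually_mono)

lemma hol_fourier_class_eq:
  assumes f: "f \<in> L2_fun n"
  shows "hol_fourier_class (ae_rel n `` {f}) = hol_fourier f"
proof -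
  have "hol_fourier h = hol_fourier f" if "h \<in> ae_rel n `` {f}" for h
    using that hol_fourier_ae_rel[of f h n] by simp
  moreover have "ae_rel n `` {f} \<noteq> {}"
    using equiv_class_self[OF equiv_ae_rel f] by blast
  ultimately show ?thesis
    unfolding hol_fourier_class_def by (intro the_elem_image_unique)
qed

lemma vnorm_L2_class:
  assumes f: "f \<in> L2_fun n"
  shows "vnorm (L2 n) (ae_rel n `` {f}) = enn2real (L2_fun_norm n f)"
proof -
  have "L2_fun_norm n h = L2_fun_norm n f" if "h \<in> ae_rel n `` {f}" for h
    using that L2_fun_norm_ae_rel[of f h n] by simp
  moreover have "ae_rel n `` {f} \<noteq> {}"
    using equiv_class_self[OF equiv_ae_rel f] by blast
  ultimately have "the_elem (L2_fun_norm n ` (ae_rel n `` {f})) = L2_fun_norm n f"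
    by (intro the_elem_image_unique)
  then show ?thesis by (simp add: L2_def)
qed

lemma vadd_L2_class:
  assumes f: "f \<in> L2_fun n" and g: "g \<in> L2_fun n"
  shows "vadd (L2 n) (ae_rel n `` {f}) (ae_rel n `` {g}) = ae_rel n `` {\<lambda>x. f x + g x}"
proof -
  have "congruent2 (ae_rel n) (ae_rel n) (\<lambda>f g. ae_rel n `` {\<lambda>x. f x + g x})"
    by (intro congruent2I' equiv_class_eq[OF equiv_ae_rel] ae_rel_add)
  from UN_equiv_class2[OF equiv_ae_rel equiv_ae_rel this f g] show ?thesis
    by (simp add: L2_def)
qed

lemma vscale_L2_class:
  assumes f: "f \<in> L2_fun n"
  shows "vscale (L2 n) c (ae_rel n `` {f}) = ae_rel n `` {\<lambda>x. c * f x}"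
proof -
  have "congruent (ae_rel n) (\<lambda>f. ae_rel n `` {\<lambda>x. c * f x})"
    by (intro congruentI equiv_class_eq[OF equiv_ae_rel] ae_rel_scale)
  from UN_equiv_class[OF equiv_ae_rel this f] show ?thesis
    by (simp add: L2_def)
qed

lemma vecs_L2_cases:
  assumes "A \<in> vecs (L2 n)"
  obtains f where "f \<in> L2_fun n" "A = ae_rel n `` {f}"
  using assms by (auto simp: L2_def elim: quotientE)

lemma bij_hol_fourier_class: "bij_betw hol_fourier_class (vecs (L2 n)) (vecs (H2 n))"
  unfolding bij_betw_def
proof
  show "inj_on hol_fourier_class (vecs (L2 n))"
  proof (rule inj_onI)
    fix A B assume A: "A \<in> vecs (L2 n)" and B: "B \<in> vecs (L2 n)" and eq: "hol_fourier_class A = hol_fourier_class B"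
    obtain f where f: "f \<in> L2_fun n" "A = ae_rel n `` {f}" by (rule vecs_L2_cases[OF A])
    obtain g where g: "g \<in> L2_fun n" "B = ae_rel n `` {g}" by (rule vecs_L2_cases[OF B])
    have "hol_fourier f = hol_fourier g"
      using eq unfolding f(2) g(2) hol_fourier_class_eq[OF f(1)] hol_fourier_class_eq[OF g(1)] .
    then have "(f, g) \<in> ae_rel n"
      using hol_fourier_inj[OF f(1) g(1)] f(1) g(1) by (simp add: ae_rel_def)
    then show "A = B" unfolding f g by (rule equiv_class_eq[OF equiv_ae_rel])
  qed
  show "hol_fourier_class ` vecs (L2 n) = vecs (H2 n)"
  proof
    show "hol_fourier_class ` vecs (L2 n) \<subseteq> vecs (H2 n)"
      by (auto elim!: vecs_L2_cases simp: hol_fourier_class_eq hol_fourier_in_H2(1))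
    show "vecs (H2 n) \<subseteq> hol_fourier_class ` vecs (L2 n)"
    proof
      fix F assume "F \<in> vecs (H2 n)"
      then obtain f where f: "f \<in> L2_fun n" "hol_fourier f = F" using hol_fourier_surj by blast
      have "ae_rel n `` {f} \<in> vecs (L2 n)" using f(1) by (simp add: L2_def quotientI)
      then show "F \<in> hol_fourier_class ` vecs (L2 n)"
        using f hol_fourier_class_eq[OF f(1)] by (metis imageI)
    qed
  qed
qed

theorem theorem4p1:
  fixes n :: nat
  shows "(\<forall>f\<in>L2_fun n. \<forall>z\<in>Cplus.
            integrable (lebesgue_on {0<..}) (\<lambda>x. f x * exp (\<i> * z * of_real x)))
       \<and> (\<forall>A\<in>vecs (L2 n). \<forall>f\<in>A. hol_fourier_class A = hol_fourier f)
       \<and> isometric_isomorphism (L2 n) (H2 n) hol_fourier_class"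
proof (intro conjI ballI)
  show "integrable (lebesgue_on {0<..}) (\<lambda>x. f x * exp (\<i> * z * of_real x))"
    if "f \<in> L2_fun n" "z \<in> Cplus" for f z
    using that by (rule hol_fourier_integrable)
  show "hol_fourier_class A = hol_fourier f" if A: "A \<in> vecs (L2 n)" and f: "f \<in> A" for A f
  proof -
    obtain g where g: "g \<in> L2_fun n" "A = ae_rel n `` {g}" by (rule vecs_L2_cases[OF A])
    then have "hol_fourier g = hol_fourier f"
      using f by (intro hol_fourier_ae_rel[of g f n]) blast
    then show ?thesis
      using hol_fourier_class_eq[OF g(1)] unfolding g(2) by metis
  qed
  show "isometric_isomorphism (L2 n) (H2 n) hol_fourier_class"
    unfolding isometric_isomorphism_def
  proof (intro conjI ballI allI bij_hol_fourier_class)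
    fix A assume A: "A \<in> vecs (L2 n)"
    obtain f where f: "f \<in> L2_fun n" "A = ae_rel n `` {f}" by (rule vecs_L2_cases[OF A])
    show "hol_fourier_class (vscale (L2 n) c A) = vscale (H2 n) c (hol_fourier_class A)" for c
      unfolding f(2) vscale_L2_class[OF f(1)] hol_fourier_class_eq[OF f(1)] hol_fourier_class_eq[OF L2_fun_scale[OF f(1)]]
        hol_fourier_scale by (simp add: H2_def)
    show "vnorm (H2 n) (hol_fourier_class A) = vnorm (L2 n) A"
      unfolding f(2) hol_fourier_class_eq[OF f(1)] vnorm_L2_class[OF f(1)] by (rule hol_fourier_in_H2(2)[OF f(1)])
    fix B assume B: "B \<in> vecs (L2 n)"
    obtain g where g: "g \<in> L2_fun n" "B = ae_rel n `` {g}" by (rule vecs_L2_cases[OF B])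
    show "hol_fourier_class (vadd (L2 n) A B) = vadd (H2 n) (hol_fourier_class A) (hol_fourier_class B)"
      unfolding f(2) g(2) vadd_L2_class[OF f(1) g(1)] hol_fourier_class_eq[OF f(1)] hol_fourier_class_eq[OF g(1)]
        hol_fourier_class_eq[OF L2_fun_add[OF f(1) g(1)]] hol_fourier_add[OF f(1) g(1)] by (simp add: H2_def)
  qed
qed

end
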